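(* For every generalized core spanner $P$ over a finite alphabet $\Sigma$, the spanner relation $R^P$ can be maintained in $\mathsf{DynFO}$.
   Context: Dynamic setting. Fix a finite alphabet $\Sigma$. A word-structure $\mathcal{W}$ has domain $D=\{1,\dots,n+1\}$ (for some $n\ge 0$), the natural linear order $<$ on $D$, a constant $\$$ interpreted as $n+1$, and for each $\zeta\in\Sigma$ a unary relation $R_\zeta\subseteq\{1,\dots,n\}$, where every position belongs to at most one $R_\zeta$. Write $w(i)=\zeta$ if $R_\zeta(i)$ holds and $w(i)=\varepsilon$ otherwise; the represented word is $w=w(1)\cdots w(n)$. Positions $i$ with $w(i)\neq\varepsilon$ are symbol-elements; for a symbol-element $x$, $\mathrm{pos}_w(x)$ is the number of symbol-elements $\le x$. The updates are $\mathsf{ins}_\zeta(i)$ (put $i$ into $R_\zeta$ and no other $R_{\zeta'}$) and $\mathsf{reset}(i)$ (remove $i$ from all $R_\zeta$), $i\in\{1,\dots,n\}$, allowed only if they change the word-structure. Initially every position is $\varepsilon$. A dynamic program consists of finitely many auxiliary relations over $D$, each initialized by a first-order formula, and for each auxiliary relation $R$ of arity $k$ and each abstract update $\mathsf{op}$ an update formula $\varphi^R_{\mathsf{op}}(y;x_1,\dots,x_k)$; after applying $\mathsf{op}$ at position $i$, the new $R$ consists of the tuples $\vec j$ with $\varphi^R_{\mathsf{op}}(i;\vec j)$ true in the updated word-structure together with the old auxiliary relations. A program maintains a relation if a designated auxiliary relation equals it after every finite sequence of updates. $\mathsf{DynFO}$ is the class of relations maintainable with first-order update formulas. Spanners. For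 $w=a_1\cdots a_n$, a span is $[i,j\rangle$ with $1\le i\le j\le n+1$, and $w_{[i,j\rangle}=a_i\cdots a_{j-1}$. A spanner $P$ with finite variable set $\mathrm{SVars}(P)=V$ maps each $w\in\Sigma^*$ to a set of functions from $V$ to spans of $w$. A regex formula is a regular expression over $\Sigma$ that may contain subexpressions $x\{\alpha\}$ for variables $x$; it generates ref-words over $\Sigma\cup\{\vdash_x,\dashv_x\}$ ($x\{\alpha\}$ generating $\vdash_x r\dashv_x$); it is functional if every generated ref-word contains $\vdash_x$ exactly once for every variable $x$ in it. A functional regex formula defines the spanner mapping $w$ to all $\mu^r$ for generated ref-words $r$ whose marker-deletion $c(r)$ is $w$, with $\mu^r(x)=[|c(r_1)|+1,|c(r_1r_2)|+1\rangle$ where $r=r_1\vdash_x r_2\dashv_x r_3$. Generalized core spanners are obtained from spanners defined by functional regex formulas by finitely many applications of union, set difference (both for spanners with equal variable sets, pointwise on $P(w)$), projection $\pi_Y$, natural join, and string-equality selection $\xi^=_{x,y}P(w)=\{\mu\in P(w):w_{\mu(x)}=w_{\mu(y)}\}$. Spanner relation. For $\mathrm{SVars}(P)=\{x_1,\dots,x_k\}$, $R^P$ is the $2k$-ary relation over $D$ containing $(x_1^o,x_1^c,\dots,x_k^o,x_k^c)$ iff some $\mu\in P(w)$ has $\mu(x_i)=[\mathrm{pos}_w(x_i^o),\mathrm{pos}_w(x_i^c)\rangle$ for all $i$, where an endpoint $|w|+1$ is represented by $\$$. *)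

theory Defs
  imports Main
begin

section \<open>Word-structures\<close>

text \<open>
  A structure of extent \<open>n\<close> has domain \<open>{1, \<dots>, n + 1}\<close>. The relations \<open>R\<^sub>\<zeta>\<close> are encoded jointly
  by \<open>label\<close>: \<open>R\<^sub>\<zeta>(i)\<close> holds iff \<open>label W i = Some \<zeta>\<close>, and \<open>label W i = None\<close> stands for
  \<open>w(i) = \<epsilon>\<close>. Thus every position belongs to at most one \<open>R\<^sub>\<zeta>\<close>.
\<close>

record 'a word_structure =
  extent :: nat
  label :: "nat \<Rightarrow> 'a option"

definition dom_of :: "'a word_structure \<Rightarrow> nat set" where
  "dom_of W = {1..extent W + 1}"

definition dollar :: "'a word_structure \<Rightarrow> nat" where
  "dollar W = extent W + 1"

definition word_of :: "'a word_structure \<Rightarrow> 'a list" where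
  "word_of W = List.map_filter (label W) [1..<extent W + 1]"

definition symbol_element :: "'a word_structure \<Rightarrow> nat \<Rightarrow> bool" where
  "symbol_element W i \<longleftrightarrow> 1 \<le> i \<and> i \<le> extent W \<and> label W i \<noteq> None"

definition pos :: "'a word_structure \<Rightarrow> nat \<Rightarrow> nat" where
  "pos W x = card {i. symbol_element W i \<and> i \<le> x}"

definition initial_structure :: "nat \<Rightarrow> 'a word_structure" where
  "initial_structure n = \<lparr>extent = n, label = (\<lambda>_. None)\<rparr>"

datatype 'a abs_update = Ins 'a | Reset

fun apply_update :: "'a abs_update \<Rightarrow> nat \<Rightarrow> 'a word_structure \<Rightarrow> 'a word_structure" where
  "apply_update (Ins \<zeta>) i W = W\<lparr>label := (label W)(i := Some \<zeta>)\<rparr>"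
| "apply_update Reset i W = W\<lparr>label := (label W)(i := None)\<rparr>"

definition allowed_update :: "'a abs_update \<Rightarrow> nat \<Rightarrow> 'a word_structure \<Rightarrow> bool" where
  "allowed_update u i W \<longleftrightarrow> 1 \<le> i \<and> i \<le> extent W \<and> apply_update u i W \<noteq> W"


section \<open>First-order formulas and dynamic programs\<close>

datatype tm = Var nat | Dollar

text \<open>Auxiliary relation symbols are natural numbers.\<close>

datatype 'a fm =
    Eq tm tm
  | Less tm tm
  | Lab 'a tm
  | Aux nat "tm list"
  | Neg "'a fm"
  | And "'a fm" "'a fm"
  | Or "'a fm" "'a fm"
  | Ex nat "'a fm"
  | All nat "'a fm"

fun fv_tm :: "tm \<Rightarrow> nat set" where
  "fv_tm (Var v) = {v}"
| "fv_tm Dollar = {}"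

fun fv :: "'a fm \<Rightarrow> nat set" where
  "fv (Eq s t) = fv_tm s \<union> fv_tm t"
| "fv (Less s t) = fv_tm s \<union> fv_tm t"
| "fv (Lab \<zeta> t) = fv_tm t"
| "fv (Aux r ts) = (\<Union>t \<in> set ts. fv_tm t)"
| "fv (Neg \<phi>) = fv \<phi>"
| "fv (And \<phi> \<psi>) = fv \<phi> \<union> fv \<psi>"
| "fv (Or \<phi> \<psi>) = fv \<phi> \<union> fv \<psi>"
| "fv (Ex v \<phi>) = fv \<phi> - {v}"
| "fv (All v \<phi>) = fv \<phi> - {v}"

text \<open>
  \<open>wf_fm ars \<phi>\<close>: the auxiliary symbols in \<open>\<phi>\<close> are among \<open>0, \<dots>, length ars - 1\<close>, where symbol \<open>r\<close>
  has arity \<open>ars ! r\<close>. In particular \<open>wf_fm [] \<phi>\<close> says that \<open>\<phi>\<close> speaks about the word-structure only.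
\<close>

fun wf_fm :: "nat list \<Rightarrow> 'a fm \<Rightarrow> bool" where
  "wf_fm ars (Eq s t) \<longleftrightarrow> True"
| "wf_fm ars (Less s t) \<longleftrightarrow> True"
| "wf_fm ars (Lab \<zeta> t) \<longleftrightarrow> True"
| "wf_fm ars (Aux r ts) \<longleftrightarrow> r < length ars \<and> length ts = ars ! r"
| "wf_fm ars (Neg \<phi>) \<longleftrightarrow> wf_fm ars \<phi>"
| "wf_fm ars (And \<phi> \<psi>) \<longleftrightarrow> wf_fm ars \<phi> \<and> wf_fm ars \<psi>"
| "wf_fm ars (Or \<phi> \<psi>) \<longleftrightarrow> wf_fm ars \<phi> \<and> wf_fm ars \<psi>"
| "wf_fm ars (Ex v \<phi>) \<longleftrightarrow> wf_fm ars \<phi>"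
| "wf_fm ars (All v \<phi>) \<longleftrightarrow> wf_fm ars \<phi>"

type_synonym aux_state = "nat \<Rightarrow> nat list set"

fun eval_tm :: "'a word_structure \<Rightarrow> (nat \<Rightarrow> nat) \<Rightarrow> tm \<Rightarrow> nat" where
  "eval_tm W e (Var v) = e v"
| "eval_tm W e Dollar = dollar W"

fun sat :: "'a word_structure \<Rightarrow> aux_state \<Rightarrow> (nat \<Rightarrow> nat) \<Rightarrow> 'a fm \<Rightarrow> bool" where
  "sat W A e (Eq s t) \<longleftrightarrow> eval_tm W e s = eval_tm W e t"
| "sat W A e (Less s t) \<longleftrightarrow> eval_tm W e s < eval_tm W e t"
| "sat W A e (Lab \<zeta> t) \<longleftrightarrow> label W (eval_tm W e t) = Some \<zeta>"
| "sat W A e (Aux r ts) \<longleftrightarrow> map (eval_tm W e) ts \<in> A r"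
| "sat W A e (Neg \<phi>) \<longleftrightarrow> \<not> sat W A e \<phi>"
| "sat W A e (And \<phi> \<psi>) \<longleftrightarrow> sat W A e \<phi> \<and> sat W A e \<psi>"
| "sat W A e (Or \<phi> \<psi>) \<longleftrightarrow> sat W A e \<phi> \<or> sat W A e \<psi>"
| "sat W A e (Ex v \<phi>) \<longleftrightarrow> (\<exists>d \<in> dom_of W. sat W A (e(v := d)) \<phi>)"
| "sat W A e (All v \<phi>) \<longleftrightarrow> (\<forall>d \<in> dom_of W. sat W A (e(v := d)) \<phi>)"

text \<open>
  The arguments of an initialization formula for a \<open>k\<close>-ary symbol are the variables \<open>0, \<dots>, k - 1\<close>.
  In an update formula \<open>\<phi>(y; x\<^sub>1, \<dots>, x\<^sub>k)\<close>, the updated position \<open>y\<close> is variable \<open>0\<close> and \<open>x\<^sub>j\<close> is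
  variable \<open>j\<close>.
\<close>

record 'a dyn_program =
  aux_arities :: "nat list"
  init_fm :: "nat \<Rightarrow> 'a fm"
  update_fm :: "'a abs_update \<Rightarrow> nat \<Rightarrow> 'a fm"

definition wf_program :: "'a dyn_program \<Rightarrow> bool" where
  "wf_program p \<longleftrightarrow>
     (\<forall>r < length (aux_arities p).
        wf_fm [] (init_fm p r) \<and> fv (init_fm p r) \<subseteq> {..<aux_arities p ! r} \<and>
        (\<forall>u. wf_fm (aux_arities p) (update_fm p u r) \<and> fv (update_fm p u r) \<subseteq> {..aux_arities p ! r}))"

definition tuples :: "'a word_structure \<Rightarrow> nat \<Rightarrow> nat list set" where
  "tuples W k = {js. length js = k \<and> set js \<subseteq> dom_of W}"

definition initial_aux :: "'a dyn_program \<Rightarrow> 'a word_structure \<Rightarrow> aux_state" where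
  "initial_aux p W r =
     {js \<in> tuples W (aux_arities p ! r). sat W (\<lambda>_. {}) (\<lambda>v. js ! v) (init_fm p r)}"

text \<open>Here \<open>W\<close> is the word-structure after the update and \<open>A\<close> holds the old auxiliary relations.\<close>

definition updated_aux ::
    "'a dyn_program \<Rightarrow> 'a abs_update \<Rightarrow> nat \<Rightarrow> 'a word_structure \<Rightarrow> aux_state \<Rightarrow> aux_state" where
  "updated_aux p u i W A r =
     {js \<in> tuples W (aux_arities p ! r). sat W A (\<lambda>v. (i # js) ! v) (update_fm p u r)}"

inductive reachable :: "'a dyn_program \<Rightarrow> 'a word_structure \<Rightarrow> aux_state \<Rightarrow> bool"
  for p :: "'a dyn_program" where
  init: "reachable p (initial_structure n) (initial_aux p (initial_structure n))"
| step: "reachable p W A \<Longrightarrow> allowed_update u i W \<Longrightarrow>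
    reachable p (apply_update u i W) (updated_aux p u i (apply_update u i W) A)"

definition maintains :: "'a dyn_program \<Rightarrow> nat \<Rightarrow> ('a word_structure \<Rightarrow> nat list set) \<Rightarrow> bool" where
  "maintains p r Rel \<longleftrightarrow> (\<forall>W A. reachable p W A \<longrightarrow> A r = Rel W)"

text \<open>The \<open>k\<close>-ary relations in DynFO; one program has to work for all domain sizes.\<close>

definition DynFO :: "nat \<Rightarrow> ('a::finite word_structure \<Rightarrow> nat list set) set" where
  "DynFO k = {Rel. \<exists>p r. wf_program p \<and> r < length (aux_arities p) \<and> aux_arities p ! r = k \<and>
                      maintains p r Rel}"


section \<open>Document spanners\<close>

text \<open>The span \<open>[i, j\<rangle>\<close> is the pair \<open>(i, j)\<close>.\<close>

type_synonym span = "nat \<times> nat"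

fun factor :: "'a list \<Rightarrow> span \<Rightarrow> 'a list" where
  "factor w (i, j) = take (j - i) (drop (i - 1) w)"

text \<open>The functions from \<open>V\<close> to spans are the partial maps \<open>\<mu>\<close> with \<open>dom \<mu> = V\<close>.\<close>

record ('a, 'v) spanner =
  svars :: "'v set"
  spanner_eval :: "'a list \<Rightarrow> ('v \<rightharpoonup> span) set"

datatype ('a, 'v) regex =
    Empty
  | Eps
  | Sym 'a
  | Alt "('a, 'v) regex" "('a, 'v) regex"
  | Conc "('a, 'v) regex" "('a, 'v) regex"
  | Star "('a, 'v) regex"
  | Capture 'v "('a, 'v) regex"

fun rvars :: "('a, 'v) regex \<Rightarrow> 'v set" where
  "rvars Empty = {}"
| "rvars Eps = {}"
| "rvars (Sym a) = {}"
| "rvars (Alt \<alpha> \<beta>) = rvars \<alpha> \<union> rvars \<beta>"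
| "rvars (Conc \<alpha> \<beta>) = rvars \<alpha> \<union> rvars \<beta>"
| "rvars (Star \<alpha>) = rvars \<alpha>"
| "rvars (Capture x \<alpha>) = insert x (rvars \<alpha>)"

datatype ('a, 'v) refsym = Letter 'a | Opening 'v | Closing 'v

fun ref_words :: "('a, 'v) regex \<Rightarrow> ('a, 'v) refsym list set" where
  "ref_words Empty = {}"
| "ref_words Eps = {[]}"
| "ref_words (Sym a) = {[Letter a]}"
| "ref_words (Alt \<alpha> \<beta>) = ref_words \<alpha> \<union> ref_words \<beta>"
| "ref_words (Conc \<alpha> \<beta>) = {r @ s | r s. r \<in> ref_words \<alpha> \<and> s \<in> ref_words \<beta>}"
| "ref_words (Star \<alpha>) = {concat rs | rs. set rs \<subseteq> ref_words \<alpha>}"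
| "ref_words (Capture x \<alpha>) = {Opening x # r @ [Closing x] | r. r \<in> ref_words \<alpha>}"

definition functional :: "('a, 'v) regex \<Rightarrow> bool" where
  "functional \<alpha> \<longleftrightarrow> (\<forall>r \<in> ref_words \<alpha>. \<forall>x \<in> rvars \<alpha>. count_list r (Opening x) = 1)"

fun clear :: "('a, 'v) refsym list \<Rightarrow> 'a list" where
  "clear [] = []"
| "clear (Letter a # r) = a # clear r"
| "clear (Opening x # r) = clear r"
| "clear (Closing x # r) = clear r"

text \<open>
  \<open>ref_span r x s\<close> is the graph of \<open>x \<mapsto> \<mu>\<^sup>r(x)\<close>; in a ref-word of a functional regex formula, each of
  its variables is opened and closed exactly once, so that \<open>s\<close> is uniquely determined.
\<close>

definition ref_span :: "('a, 'v) refsym list \<Rightarrow> 'v \<Rightarrow> span \<Rightarrow> bool" where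
  "ref_span r x s \<longleftrightarrow>
     (\<exists>r1 r2 r3. r = r1 @ [Opening x] @ r2 @ [Closing x] @ r3 \<and>
        s = (length (clear r1) + 1, length (clear (r1 @ r2)) + 1))"

definition regex_spanner :: "('a, 'v) regex \<Rightarrow> ('a, 'v) spanner" where
  "regex_spanner \<alpha> =
     \<lparr>svars = rvars \<alpha>,
      spanner_eval = (\<lambda>w. {\<mu>. dom \<mu> = rvars \<alpha> \<and>
        (\<exists>r \<in> ref_words \<alpha>. clear r = w \<and> (\<forall>x \<in> rvars \<alpha>. ref_span r x (the (\<mu> x))))})\<rparr>"

definition union_spanner ::
    "('a, 'v) spanner \<Rightarrow> ('a, 'v) spanner \<Rightarrow> ('a, 'v) spanner" where
  "union_spanner P Q =
     \<lparr>svars = svars P, spanner_eval = (\<lambda>w. spanner_eval P w \<union> spanner_eval Q w)\<rparr>"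

definition diff_spanner ::
    "('a, 'v) spanner \<Rightarrow> ('a, 'v) spanner \<Rightarrow> ('a, 'v) spanner" where
  "diff_spanner P Q =
     \<lparr>svars = svars P, spanner_eval = (\<lambda>w. spanner_eval P w - spanner_eval Q w)\<rparr>"

definition proj_spanner :: "'v set \<Rightarrow> ('a, 'v) spanner \<Rightarrow> ('a, 'v) spanner" where
  "proj_spanner Y P =
     \<lparr>svars = Y, spanner_eval = (\<lambda>w. (\<lambda>\<mu>. \<mu> |` Y) ` spanner_eval P w)\<rparr>"

definition join_spanner ::
    "('a, 'v) spanner \<Rightarrow> ('a, 'v) spanner \<Rightarrow> ('a, 'v) spanner" where
  "join_spanner P Q =
     \<lparr>svars = svars P \<union> svars Q,
      spanner_eval = (\<lambda>w. {\<mu>. dom \<mu> = svars P \<union> svars Q \<and>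
        \<mu> |` svars P \<in> spanner_eval P w \<and> \<mu> |` svars Q \<in> spanner_eval Q w})\<rparr>"

definition eq_select_spanner :: "'v \<Rightarrow> 'v \<Rightarrow> ('a, 'v) spanner \<Rightarrow> ('a, 'v) spanner" where
  "eq_select_spanner x y P =
     \<lparr>svars = svars P,
      spanner_eval = (\<lambda>w. {\<mu> \<in> spanner_eval P w. factor w (the (\<mu> x)) = factor w (the (\<mu> y))})\<rparr>"

inductive generalized_core_spanner :: "('a, 'v) spanner \<Rightarrow> bool" where
  regex: "functional \<alpha> \<Longrightarrow> generalized_core_spanner (regex_spanner \<alpha>)"
| union: "generalized_core_spanner P \<Longrightarrow> generalized_core_spanner Q \<Longrightarrow> svars P = svars Q \<Longrightarrow>
    generalized_core_spanner (union_spanner P Q)"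
| diff: "generalized_core_spanner P \<Longrightarrow> generalized_core_spanner Q \<Longrightarrow> svars P = svars Q \<Longrightarrow>
    generalized_core_spanner (diff_spanner P Q)"
| proj: "generalized_core_spanner P \<Longrightarrow> Y \<subseteq> svars P \<Longrightarrow>
    generalized_core_spanner (proj_spanner Y P)"
| join: "generalized_core_spanner P \<Longrightarrow> generalized_core_spanner Q \<Longrightarrow>
    generalized_core_spanner (join_spanner P Q)"
| eq_select: "generalized_core_spanner P \<Longrightarrow> x \<in> svars P \<Longrightarrow> y \<in> svars P \<Longrightarrow>
    generalized_core_spanner (eq_select_spanner x y P)"


section \<open>The spanner relation\<close>

definition represents :: "'a word_structure \<Rightarrow> nat \<Rightarrow> nat \<Rightarrow> bool" where
  "represents W d m \<longleftrightarrow>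
     (symbol_element W d \<and> m = pos W d) \<or> (d = dollar W \<and> m = length (word_of W) + 1)"

text \<open>
  The list \<open>xs\<close> enumerates the variables of \<open>P\<close> and thereby fixes the order of the components
  \<open>(x\<^sub>1\<^sup>o, x\<^sub>1\<^sup>c, \<dots>, x\<^sub>k\<^sup>o, x\<^sub>k\<^sup>c)\<close>.
\<close>

definition spanner_relation ::
    "('a, 'v) spanner \<Rightarrow> 'v list \<Rightarrow> 'a word_structure \<Rightarrow> nat list set" where
  "spanner_relation P xs W =
     {ds \<in> tuples W (2 * length xs).
        \<exists>\<mu> \<in> spanner_eval P (word_of W). \<forall>i < length xs. \<exists>a b.
          \<mu> (xs ! i) = Some (a, b) \<and>
          represents W (ds ! (2 * i)) a \<and> represents W (ds ! (2 * i + 1)) b}"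

end

theory Submission
  imports Defs
begin

text \<open>
  It suffices to maintain two kinds of base relations on half-open intervals of positions, in terms of
  which every generalized core spanner is first-order definable. The first says that two intervals carry
  the same word. When position \<open>i\<close> changes, an interval containing \<open>i\<close> is cut at \<open>i\<close> and the cut points
  are guessed in the other interval; doing this for both intervals leaves only pieces avoiding \<open>i\<close>, whose
  equality is known from the old relation, and single positions. The second says that reading an interval
  leads from one state to another, where the states are the finitely many left quotients of the
  ref-word languages involved. The ref-words of a functional regex formula contain every marker exactly
  once, so its spanner is defined by a finite disjunction over the possible orders of the markers.
  A relation that is first-order definable from maintained relations is maintained by substituting
  their update formulas into the definition.
\<close>


section \<open>Finitely many left left_quotients\<close>

text \<open>Blank positions are the obstacle for word equality: two intervals may carry the same
  word although their positions do not match up, so the counterpart of a cut in the other interval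
  has to be quantified rather than computed. The guess is complete because every factorization of
  the word of an interval is realized by a cut point (\<open>segment_split\<close>). If both
  intervals contain the changed position, one round of cutting is not enough, since the guessed
  pieces may still contain it; hence \<open>New_Eq\<close> is built over \<open>Half_Eq\<close>.

  Left quotients form a deterministic automaton in which reading a marker is a transition like any
  other. One finite set closed under quotients thus covers the letters between markers, handled by
  auxiliary relations, and the markers themselves, handled inside the formula.

  Formulas speak about positions of the structure, spanners about positions in the word.
  \<open>rank\<close> translates, but it is injective only after restriction to symbol-elements and
  the last position. The formula of a spanner must therefore also enforce that its variables are
  such endpoints.\<close>

definition left_quotient :: "'b list \<Rightarrow> 'b list set \<Rightarrow> 'b list set" where
  "left_quotient w K = {v. w @ v \<in> K}"

lemma left_quotient_Nil [simp]: "left_quotient [] K = K"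
  by (simp add: left_quotient_def)

lemma left_quotient_append: "left_quotient (u @ v) K = left_quotient v (left_quotient u K)"
  by (simp add: left_quotient_def)

lemma Nil_in_quotient: "[] \<in> left_quotient w K \<longleftrightarrow> w \<in> K"
  by (simp add: left_quotient_def)

text \<open>By Myhill and Nerode, these are the states of the minimal complete deterministic
  automaton of \<open>K\<close>; finiteness is regularity.\<close>

abbreviation left_quotients :: "'b list set \<Rightarrow> 'b list set set" where
  "left_quotients K \<equiv> range (\<lambda>w. left_quotient w K)"

definition lang_conc :: "'b list set \<Rightarrow> 'b list set \<Rightarrow> 'b list set" where
  "lang_conc A B = {r @ s | r s. r \<in> A \<and> s \<in> B}"

definition lang_star :: "'b list set \<Rightarrow> 'b list set" where
  "lang_star A = {concat rs | rs. set rs \<subseteq> A}"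

lemma finite_quotients_singleton: "finite (left_quotients {[c]})"
proof -
  have "left_quotient w {[c]} \<in> {{[c]}, {[]}, {}}" for w
    by (cases w) (auto simp: left_quotient_def)
  then have "left_quotients {[c]} \<subseteq> {{[c]}, {[]}, {}}"
    by blast
  then show ?thesis
    by (rule finite_subset) simp
qed

lemma finite_quotients_Un:
  assumes "finite (left_quotients A)" "finite (left_quotients B)"
  shows "finite (left_quotients (A \<union> B))"
proof -
  have "left_quotient w (A \<union> B) = left_quotient w A \<union> left_quotient w B" for w
    by (auto simp: left_quotient_def)
  then have "left_quotients (A \<union> B) \<subseteq> (\<lambda>(X, Y). X \<union> Y) ` (left_quotients A \<times> left_quotients B)"
    by auto
  then show ?thesis
    using assms by (meson finite_SigmaI finite_imageI finite_subset)
qed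

text \<open>In \<open>w @ t = r @ s\<close> the border between \<open>r\<close> and \<open>s\<close>
  lies either inside \<open>t\<close>, which gives the first part, or inside \<open>w\<close>, which
  gives a quotient of \<open>B\<close> by a suffix of \<open>w\<close>.\<close>

lemma quotient_lang_conc:
  "left_quotient w (lang_conc A B) =
     lang_conc (left_quotient w A) B \<union> \<Union> {left_quotient v B | u v. w = u @ v \<and> u \<in> A}"
proof (intro set_eqI iffI)
  fix t
  assume "t \<in> left_quotient w (lang_conc A B)"
  then obtain r s where *: "w @ t = r @ s" "r \<in> A" "s \<in> B"
    by (auto simp: left_quotient_def lang_conc_def)
  then consider x where "w = r @ x" "x @ t = s" | x where "w @ x = r" "t = x @ s"
    by (auto simp: append_eq_append_conv2)
  then show "t \<in> lang_conc (left_quotient w A) B \<union> \<Union> {left_quotient v B | u v. w = u @ v \<and> u \<in> A}"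
  proof cases
    case 1
    then have "t \<in> left_quotient x B"
      using * by (simp add: left_quotient_def)
    then show ?thesis
      using 1 * by blast
  next
    case 2
    then show ?thesis
      using * by (auto simp: left_quotient_def lang_conc_def)
  qed
next
  fix t
  assume "t \<in> lang_conc (left_quotient w A) B \<union> \<Union> {left_quotient v B | u v. w = u @ v \<and> u \<in> A}"
  then consider r s where "t = r @ s" "w @ r \<in> A" "s \<in> B"
    | u v where "w = u @ v" "u \<in> A" "v @ t \<in> B"
    by (auto simp: left_quotient_def lang_conc_def)
  then have "\<exists>r s. w @ t = r @ s \<and> r \<in> A \<and> s \<in> B"
    by cases (metis append_assoc)+
  then show "t \<in> left_quotient w (lang_conc A B)"
    by (auto simp: left_quotient_def lang_conc_def)
qed

text \<open>By \<open>quotient_lang_conc\<close>, a quotient is determined by one quotient of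
  \<open>A\<close> and a set of quotients of \<open>B\<close>, as in a subset construction.\<close>

lemma finite_quotients_lang_conc:
  assumes "finite (left_quotients A)" "finite (left_quotients B)"
  shows "finite (left_quotients (lang_conc A B))"
proof -
  have "left_quotient w (lang_conc A B) \<in>
      (\<lambda>(X, S). lang_conc X B \<union> \<Union> S) ` (left_quotients A \<times> Pow (left_quotients B))" for w
    unfolding quotient_lang_conc by (rule image_eqI[OF _ SigmaI]) (auto intro!: arg_cong2[of _ _ _ _ "(\<union>)"])
  then have "left_quotients (lang_conc A B) \<subseteq>
      (\<lambda>(X, S). lang_conc X B \<union> \<Union> S) ` (left_quotients A \<times> Pow (left_quotients B))"
    by blast
  then show ?thesis
    using assms by (meson finite_Pow_iff finite_SigmaI finite_imageI finite_subset)
qed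

lemma lang_star_append: "u \<in> lang_star A \<Longrightarrow> v \<in> lang_star A \<Longrightarrow> u @ v \<in> lang_star A"
  unfolding lang_star_def by clarsimp (metis concat_append set_append Un_least)

lemma lang_star_Nil: "[] \<in> lang_star A"
  unfolding lang_star_def by (auto intro!: exI[of _ "[]"])

lemma lang_star_single: "u \<in> A \<Longrightarrow> u \<in> lang_star A"
  unfolding lang_star_def by (auto intro!: exI[of _ "[u]"])

text \<open>The end of \<open>w\<close> falls into one factor \<open>v @ t1\<close> of the
  concatenation; \<open>u\<close> collects the factors before it and \<open>t2\<close> those after
  it. If it falls between two factors, it is attributed to the earlier one, with
  \<open>t1 = []\<close>; that factor exists because \<open>w\<close> is nonempty.\<close>

lemma concat_eq_append_split:
  assumes "concat rs = w @ t" "set rs \<subseteq> A" "w \<noteq> []"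
  shows "\<exists>u v t1 t2. w = u @ v \<and> u \<in> lang_star A \<and> t = t1 @ t2 \<and> v @ t1 \<in> A \<and> t2 \<in> lang_star A"
  using assms
proof (induction rs arbitrary: w)
  case (Cons r rs)
  have rs: "concat rs \<in> lang_star A" and r: "r \<in> A"
    using Cons.prems by (auto simp: lang_star_def)
  from Cons.prems consider x where "r = w @ x" "x @ concat rs = t"
    | x where "r @ x = w" "concat rs = x @ t"
    by (auto simp: append_eq_append_conv2)
  then show ?case
  proof cases
    case 1
    then show ?thesis
      using r rs lang_star_Nil by (intro exI[of _ "[]"] exI[of _ w] exI[of _ x] exI[of _ "concat rs"]) auto
  next
    case 2
    show ?thesis
    proof (cases "x = []")
      case True
      then show ?thesis
        using 2 r rs lang_star_Nil
        by (intro exI[of _ "[]"] exI[of _ w] exI[of _ "[]"] exI[of _ "concat rs"]) auto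
    next
      case False
      then obtain u v t1 t2 where "x = u @ v" "u \<in> lang_star A" "t = t1 @ t2" "v @ t1 \<in> A"
          "t2 \<in> lang_star A"
        using Cons.IH[OF 2(2)] Cons.prems by auto
      then show ?thesis
        using 2(1) lang_star_append[OF lang_star_single[OF r]]
        by (intro exI[of _ "r @ u"] exI[of _ v] exI[of _ t1] exI[of _ t2]) simp
    qed
  qed
qed simp

lemma quotient_lang_star:
  assumes "w \<noteq> []"
  shows "left_quotient w (lang_star A) =
    (\<Union>X \<in> {left_quotient v A | u v. w = u @ v \<and> u \<in> lang_star A}. lang_conc X (lang_star A))"
proof (intro set_eqI iffI)
  fix t
  assume "t \<in> left_quotient w (lang_star A)"
  then obtain rs where "concat rs = w @ t" "set rs \<subseteq> A"
    by (auto simp: left_quotient_def lang_star_def)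
  from concat_eq_append_split[OF this assms] obtain u v t1 t2
    where *: "w = u @ v" "u \<in> lang_star A" "t = t1 @ t2" "v @ t1 \<in> A" "t2 \<in> lang_star A"
    by blast
  then have "t \<in> lang_conc (left_quotient v A) (lang_star A)"
    by (auto simp: left_quotient_def lang_conc_def)
  then show "t \<in> (\<Union>X \<in> {left_quotient v A | u v. w = u @ v \<and> u \<in> lang_star A}. lang_conc X (lang_star A))"
    using *(1,2) by blast
next
  fix t
  assume "t \<in> (\<Union>X \<in> {left_quotient v A | u v. w = u @ v \<and> u \<in> lang_star A}. lang_conc X (lang_star A))"
  then obtain u v t1 t2 where *: "w = u @ v" "u \<in> lang_star A" "v @ t1 \<in> A" "t2 \<in> lang_star A"
      "t = t1 @ t2"
    by (auto simp: left_quotient_def lang_conc_def)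
  then have "u @ (v @ t1) @ t2 \<in> lang_star A"
    by (blast intro: lang_star_append lang_star_single)
  then show "t \<in> left_quotient w (lang_star A)"
    using * by (simp add: left_quotient_def)
qed

lemma finite_quotients_lang_star:
  assumes "finite (left_quotients A)"
  shows "finite (left_quotients (lang_star A))"
proof -
  let ?F = "\<lambda>S. \<Union>X \<in> S. lang_conc X (lang_star A)"
  \<comment> \<open>The empty word is outside the scope of \<open>quotient_lang_star\<close>; its
    quotient is the star itself and is added separately.\<close>
  have "left_quotient w (lang_star A) \<in> insert (lang_star A) (?F ` Pow (left_quotients A))" for w
  proof (cases "w = []")
    case False
    then show ?thesis
      unfolding quotient_lang_star[OF False] by (intro insertI2 imageI) auto
  qed simp
  then have "left_quotients (lang_star A) \<subseteq> insert (lang_star A) (?F ` Pow (left_quotients A))"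
    by blast
  then show ?thesis
    using assms by (meson finite_Pow_iff finite_imageI finite_insert finite_subset)
qed

text \<open>Markers count as ordinary letters, so a capture is just a concatenation with two
  singletons. The type of ref-symbols may be infinite: what is counted are the quotients, not the
  symbols.\<close>

lemma finite_quotients_ref_words: "finite (left_quotients (ref_words \<alpha>))"
proof (induction \<alpha>)
  case Empty
  have "left_quotients {} \<subseteq> {{}}"
    by (auto simp: left_quotient_def)
  then show ?case
    by (metis finite.emptyI finite_insert finite_subset ref_words.simps(1))
next
  case Eps
  have "left_quotient w {[]} \<in> {{[]}, {}}" for w
    by (cases w) (auto simp: left_quotient_def)
  then have "left_quotients {[]} \<subseteq> {{[]}, {}}"
    by blast
  then show ?case
    by (metis finite.emptyI finite_insert finite_subset ref_words.simps(2))
next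
  case (Sym a)
  then show ?case
    using finite_quotients_singleton by simp
next
  case (Alt \<alpha> \<beta>)
  then show ?case
    using finite_quotients_Un by simp
next
  case (Conc \<alpha> \<beta>)
  have "ref_words (Conc \<alpha> \<beta>) = lang_conc (ref_words \<alpha>) (ref_words \<beta>)"
    by (simp add: lang_conc_def)
  then show ?case
    using Conc finite_quotients_lang_conc by metis
next
  case (Star \<alpha>)
  have "ref_words (Star \<alpha>) = lang_star (ref_words \<alpha>)"
    by (simp add: lang_star_def)
  then show ?case
    using Star finite_quotients_lang_star by metis
next
  case (Capture x \<alpha>)
  have "ref_words (Capture x \<alpha>) = lang_conc {[Opening x]} (lang_conc (ref_words \<alpha>) {[Closing x]})"
    by (force simp: lang_conc_def)
  then show ?case
    using Capture finite_quotients_lang_conc finite_quotients_singleton by metis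
qed


section \<open>Segments of a word-structure\<close>

text \<open>With half-open intervals, adjacent segments concatenate, and the changed position
  \<open>i\<close> is isolated as the interval from \<open>i\<close> to
  \<open>Suc i\<close>.\<close>

definition segment :: "'a word_structure \<Rightarrow> nat \<Rightarrow> nat \<Rightarrow> 'a list" where
  "segment W a b = List.map_filter (label W) [a..<b]"

lemma map_filter_append: "List.map_filter f (xs @ ys) = List.map_filter f xs @ List.map_filter f ys"
  by (simp add: List.map_filter_def)

lemma word_of_segment: "word_of W = segment W 1 (dollar W)"
  by (simp add: word_of_def segment_def dollar_def)

lemma segment_append:
  assumes "a \<le> m" "m \<le> b"
  shows "segment W a b = segment W a m @ segment W m b"
  using assms upt_add_eq_append[of a m "b - m"] by (simp add: segment_def flip: map_filter_append)

lemma segment_empty [simp]: "b \<le> a \<Longrightarrow> segment W a b = []"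
  by (simp add: segment_def List.map_filter_def)

lemma segment_single: "segment W a (Suc a) = (case label W a of None \<Rightarrow> [] | Some \<zeta> \<Rightarrow> [\<zeta>])"
  by (auto simp: segment_def List.map_filter_def split: option.splits)

lemma segment_cong: "(\<And>j. a \<le> j \<Longrightarrow> j < b \<Longrightarrow> label W j = label W' j) \<Longrightarrow> segment W a b = segment W' a b"
  unfolding segment_def List.map_filter_def by (intro map_cong filter_cong arg_cong[of _ _ the]) auto

lemma segment_eq_Nil_iff: "segment W a b = [] \<longleftrightarrow> (\<forall>j. a \<le> j \<longrightarrow> j < b \<longrightarrow> label W j = None)"
  by (auto simp: segment_def List.map_filter_def filter_empty_conv)

lemma segment_symbol:
  assumes "a \<le> e" "e < b" "label W e = Some \<zeta>"
  shows "segment W a b = segment W a e @ \<zeta> # segment W (Suc e) b"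
  using assms segment_append[of a e b W] segment_append[of e "Suc e" b W]
  by (simp add: segment_single)

text \<open>Each position contributes at most one letter, so no factorization of the word can cut
  through a position. The cut point need not be unique, since it can move across blank
  positions.\<close>

lemma segment_split:
  assumes "segment W c d = u @ v" "c \<le> d"
  shows "\<exists>m. c \<le> m \<and> m \<le> d \<and> segment W c m = u \<and> segment W m d = v"
  using assms(2,1)
proof (induction d arbitrary: v rule: dec_induct)
  case (step d)
  have app: "segment W c' (Suc d) = segment W c' d @ segment W d (Suc d)" if "c' \<le> d" for c'
    using that by (intro segment_append) auto
  show ?case
  proof (cases "label W d")
    case None
    then have "segment W c d = u @ v"
      using app[of c] step by (simp add: segment_single)
    then obtain m where "c \<le> m" "m \<le> d" "segment W c m = u" "segment W m d = v"
      using step.IH by blast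
    then show ?thesis
      using app[of m] None by (intro exI[of _ m]) (simp add: segment_single)
  next
    case (Some \<zeta>)
    \<comment> \<open>The last position carries the last letter. If \<open>v\<close> is empty, the
      cut lies behind that position; otherwise the letter is the last one of \<open>v\<close>, and
      the cut is inherited from the shorter interval.\<close>
    show ?thesis
    proof (cases v rule: rev_cases)
      case Nil
      then show ?thesis
        using step by (intro exI[of _ "Suc d"]) simp
    next
      case (snoc v' \<xi>)
      then have "segment W c d = u @ v'" "\<xi> = \<zeta>"
        using app[of c] step Some by (auto simp: segment_single simp flip: append_assoc)
      moreover from this obtain m where "c \<le> m" "m \<le> d" "segment W c m = u" "segment W m d = v'"
        using step.IH by blast
      ultimately show ?thesis
        using app[of m] Some snoc by (intro exI[of _ m]) (simp add: segment_single)
    qed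
  qed
qed (auto intro!: exI[of _ c])

text \<open>The right-hand side is first-order over the word-structure; \<open>Inserted\<close> is
  its transcription.\<close>

lemma segment_eq_singleton_iff:
  "segment W a b = [\<zeta>] \<longleftrightarrow>
     (\<exists>e. a \<le> e \<and> e < b \<and> label W e = Some \<zeta> \<and>
        (\<forall>j. a \<le> j \<longrightarrow> j < b \<longrightarrow> j \<noteq> e \<longrightarrow> label W j = None))" (is "?L \<longleftrightarrow> ?R")
proof
  assume L: ?L
  then obtain e where e: "a \<le> e" "e < b" "label W e \<noteq> None"
    using segment_eq_Nil_iff[of W a b] by auto
  then obtain \<xi> where "label W e = Some \<xi>"
    by blast
  then have "\<xi> = \<zeta>" "segment W a e = []" "segment W (Suc e) b = []"
    using segment_symbol[OF e(1,2), of W \<xi>] L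
    by (auto simp: append_eq_Cons_conv Cons_eq_append_conv)
  then show ?R
    using e \<open>label W e = Some \<xi>\<close> unfolding segment_eq_Nil_iff
    by (intro exI[of _ e]) (auto simp: not_less_eq_eq[symmetric] dest: leI le_neq_implies_less)
next
  assume ?R
  then obtain e where e: "a \<le> e" "e < b" "label W e = Some \<zeta>"
      "\<And>j. a \<le> j \<Longrightarrow> j < b \<Longrightarrow> j \<noteq> e \<Longrightarrow> label W j = None"
    by blast
  then have "segment W a e = []" "segment W (Suc e) b = []"
    by (auto simp: segment_eq_Nil_iff)
  then show ?L
    using segment_symbol[OF e(1-3)] by simp
qed

section \<open>The effect of one update on segments and their equality\<close>

lemma extent_apply_update [simp]: "extent (apply_update u i W) = extent W"
  by (cases u) auto

lemma dom_of_apply_update [simp]: "dom_of (apply_update u i W) = dom_of W"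
  by (simp add: dom_of_def)

lemma dollar_apply_update [simp]: "dollar (apply_update u i W) = dollar W"
  by (simp add: dollar_def)

fun inserted :: "'a abs_update \<Rightarrow> 'a list" where
  "inserted (Ins \<zeta>) = [\<zeta>]"
| "inserted Reset = []"

lemma segment_apply_update_outside:
  "\<not> (a \<le> i \<and> i < b) \<Longrightarrow> segment (apply_update u i W) a b = segment W a b"
  by (rule segment_cong) (cases u, auto)

lemma segment_apply_update_single: "segment (apply_update u i W) i (Suc i) = inserted u"
  by (cases u) (auto simp: segment_single)

lemma segment_apply_update_inside:
  assumes "a \<le> i" "i < b"
  shows "segment (apply_update u i W) a b = segment W a i @ inserted u @ segment W (Suc i) b"
  using assms segment_append[of a i b "apply_update u i W"]
    segment_append[of i "Suc i" b "apply_update u i W"]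
  by (simp add: segment_apply_update_outside segment_apply_update_single)

lemma segment_initial [simp]: "segment (initial_structure n) a b = []"
  by (simp add: segment_def initial_structure_def List.map_filter_def)

text \<open>Both factors have to be non-degenerate so that an equality can be split at an inner position.\<close>

definition seg_eq :: "'a word_structure \<Rightarrow> nat \<Rightarrow> nat \<Rightarrow> nat \<Rightarrow> nat \<Rightarrow> bool" where
  "seg_eq W a b c d \<longleftrightarrow> a \<le> b \<and> c \<le> d \<and> segment W a b = segment W c d"

lemma seg_eq_commute: "seg_eq W a b c d \<longleftrightarrow> seg_eq W c d a b"
  by (auto simp: seg_eq_def)

lemma seg_eq_split:
  assumes "a \<le> m" "m \<le> b"
  shows "seg_eq W a b c d \<longleftrightarrow> (\<exists>m'. seg_eq W a m c m' \<and> seg_eq W m b m' d)"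
proof
  assume *: "seg_eq W a b c d"
  then have "segment W c d = segment W a m @ segment W m b" "c \<le> d"
    using assms segment_append[of a m b W] by (auto simp: seg_eq_def)
  then obtain m' where "c \<le> m'" "m' \<le> d" "segment W c m' = segment W a m"
      "segment W m' d = segment W m b"
    using segment_split by blast
  then show "\<exists>m'. seg_eq W a m c m' \<and> seg_eq W m b m' d"
    using assms by (auto simp: seg_eq_def)
next
  assume "\<exists>m'. seg_eq W a m c m' \<and> seg_eq W m b m' d"
  then show "seg_eq W a b c d"
    using assms segment_append[of a m b W] segment_append[of c _ d W] by (auto simp: seg_eq_def)
qed

lemma seg_eq_apply_update_outside:
  assumes "\<not> (a \<le> i \<and> i < b)" "\<not> (c \<le> i \<and> i < d)"
  shows "seg_eq (apply_update u i W) a b c d \<longleftrightarrow> seg_eq W a b c d"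
  using assms by (simp add: seg_eq_def segment_apply_update_outside)

text \<open>The first interval is cut before and after \<open>i\<close>. Its middle piece then
  carries the known word \<open>inserted u\<close>, so only its two outer pieces, which avoid
  \<open>i\<close>, are still compared with unknown words.\<close>

lemma seg_eq_split_single:
  assumes "a \<le> i" "i < b"
  shows "seg_eq (apply_update u i W) a b c d \<longleftrightarrow>
    (\<exists>c1 c2. seg_eq (apply_update u i W) a i c c1 \<and> c1 \<le> c2 \<and>
       segment (apply_update u i W) c1 c2 = inserted u \<and> seg_eq (apply_update u i W) (Suc i) b c2 d)"
  using assms seg_eq_split[of a i b "apply_update u i W" c d]
    seg_eq_split[of i "Suc i" b "apply_update u i W" _ d]
  by (auto simp: seg_eq_def[of _ i "Suc i"] segment_apply_update_single) metis+


section \<open>First-order formulas for the updates\<close>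

abbreviation Le :: "tm \<Rightarrow> tm \<Rightarrow> 'a fm" where
  "Le s t \<equiv> Neg (Less t s)"

fun disj :: "'a fm list \<Rightarrow> 'a fm" where
  "disj [] = Neg (Eq Dollar Dollar)"
| "disj (\<phi> # \<phi>s) = Or \<phi> (disj \<phi>s)"

lemma sat_disj [simp]: "sat W A e (disj \<phi>s) \<longleftrightarrow> (\<exists>\<phi> \<in> set \<phi>s. sat W A e \<phi>)"
  by (induction \<phi>s) auto

lemma wf_fm_disj [simp]: "wf_fm ars (disj \<phi>s) \<longleftrightarrow> (\<forall>\<phi> \<in> set \<phi>s. wf_fm ars \<phi>)"
  by (induction \<phi>s) auto

lemma fv_disj [simp]: "fv (disj \<phi>s) = (\<Union>\<phi> \<in> set \<phi>s. fv \<phi>)"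
  by (induction \<phi>s) auto

definition alphabet :: "'a::finite list" where
  "alphabet = (SOME l. set l = UNIV)"

lemma set_alphabet [simp]: "set alphabet = UNIV"
  unfolding alphabet_def using finite_list[OF finite_UNIV] by (rule someI_ex)

definition Blank :: "tm \<Rightarrow> 'a::finite fm" where
  "Blank t = Neg (disj (map (\<lambda>\<zeta>. Lab \<zeta> t) alphabet))"

lemma Blank_simps [simp]:
  "sat W A e (Blank t) \<longleftrightarrow> label W (eval_tm W e t) = None"
  "wf_fm ars (Blank t)"
  "fv (Blank t) = fv_tm t"
  by (auto simp: Blank_def)

fun max_var :: "tm \<Rightarrow> nat" where
  "max_var (Var v) = v"
| "max_var Dollar = 0"

lemma eval_tm_fresh [simp]: "max_var t < v \<Longrightarrow> eval_tm W (e(v := d)) t = eval_tm W e t"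
  by (cases t) auto

definition Inside :: "tm \<Rightarrow> tm \<Rightarrow> tm \<Rightarrow> 'a fm" where
  "Inside y a b = And (Le a y) (Less y b)"

lemma Inside_simps [simp]:
  "sat W A e (Inside y a b) \<longleftrightarrow> eval_tm W e a \<le> eval_tm W e y \<and> eval_tm W e y < eval_tm W e b"
  "wf_fm ars (Inside y a b)"
  "fv (Inside y a b) = fv_tm a \<union> fv_tm y \<union> fv_tm b"
  by (auto simp: Inside_def)

definition Succ :: "tm \<Rightarrow> nat \<Rightarrow> 'a fm" where
  "Succ y s = And (Less y (Var s))
     (All (Suc s) (Neg (And (Less y (Var (Suc s))) (Less (Var (Suc s)) (Var s)))))"

lemma Succ_simps [simp]:
  "wf_fm ars (Succ y s)"
  "fv (Succ y s) = insert s (fv_tm y)"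
  by (auto simp: Succ_def)

text \<open>If the value of \<open>s\<close> exceeded the successor of \<open>y\<close>, that
  successor would lie below a domain element, hence in the domain, and would be an element strictly
  in between.\<close>

lemma sat_Succ [simp]:
  assumes "max_var y < s" "e s \<in> dom_of W"
  shows "sat W A e (Succ y s) \<longleftrightarrow> e s = Suc (eval_tm W e y)"
proof
  assume *: "sat W A e (Succ y s)"
  show "e s = Suc (eval_tm W e y)"
  proof (rule ccontr)
    assume "e s \<noteq> Suc (eval_tm W e y)"
    with * have "Suc (eval_tm W e y) < e s"
      by (simp add: Succ_def)
    moreover from this have "Suc (eval_tm W e y) \<in> dom_of W"
      using assms by (simp add: dom_of_def)
    ultimately show False
      using * assms by (auto simp: Succ_def)
  qed
qed (use assms in \<open>auto simp: Succ_def\<close>)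

text \<open>In this and the following formulas, the variables from \<open>z\<close> on have to be fresh.\<close>

fun Inserted :: "'a::finite abs_update \<Rightarrow> tm \<Rightarrow> tm \<Rightarrow> nat \<Rightarrow> 'a fm" where
  "Inserted (Ins \<zeta>) c d z =
     Ex z (And (Inside (Var z) c d) (And (Lab \<zeta> (Var z))
       (All (Suc z) (Or (Neg (Inside (Var (Suc z)) c d))
          (Or (Eq (Var (Suc z)) (Var z)) (Blank (Var (Suc z))))))))"
| "Inserted Reset c d z = All z (Or (Neg (Inside (Var z) c d)) (Blank (Var z)))"

lemma wf_fm_Inserted [simp]: "wf_fm ars (Inserted u c d z)"
  by (cases u) auto

lemma fv_Inserted: "fv (Inserted u c d z) \<subseteq> fv_tm c \<union> fv_tm d"
  by (cases u) auto

lemma between_in_dom: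
  "a \<in> dom_of W \<Longrightarrow> b \<in> dom_of W \<Longrightarrow> a \<le> j \<Longrightarrow> j < b \<Longrightarrow> j \<in> dom_of W"
  by (simp add: dom_of_def)

lemma sat_Inserted [simp]:
  assumes "max_var c < z" "max_var d < z" "eval_tm W e c \<in> dom_of W" "eval_tm W e d \<in> dom_of W"
  shows "sat W A e (Inserted u c d z) \<longleftrightarrow> segment W (eval_tm W e c) (eval_tm W e d) = inserted u"
proof (cases u)
  case (Ins \<zeta>)
  then show ?thesis
    using assms between_in_dom[OF assms(3,4)]
    by (auto simp: segment_eq_singleton_iff Bex_def) metis+
next
  case Reset
  then show ?thesis
    using assms between_in_dom[OF assms(3,4)] by (auto simp: segment_eq_Nil_iff)
qed

text \<open>In \<open>Half_Eq\<close> and \<open>New_Eq\<close>, variable \<open>0\<close> holds the updated position, and symbol \<open>0\<close> denotes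
  the old equality relation. \<open>Half_Eq\<close> is correct only if the updated
  position lies outside the second interval.\<close>

definition Half_Eq ::
    "'a::finite abs_update \<Rightarrow> tm \<Rightarrow> tm \<Rightarrow> tm \<Rightarrow> tm \<Rightarrow> nat \<Rightarrow> 'a fm" where
  "Half_Eq u a b c d z =
     Or (And (Neg (Inside (Var 0) a b)) (Aux 0 [a, b, c, d]))
        (And (Inside (Var 0) a b) (Ex z (And (Succ (Var 0) z) (Ex (z + 1) (Ex (z + 2)
           (And (Aux 0 [a, Var 0, c, Var (z + 1)])
           (And (And (Le (Var (z + 1)) (Var (z + 2))) (Inserted u (Var (z + 1)) (Var (z + 2)) (z + 3)))
                (Aux 0 [Var z, b, Var (z + 2), d]))))))))"

definition New_Eq ::
    "'a::finite abs_update \<Rightarrow> tm \<Rightarrow> tm \<Rightarrow> tm \<Rightarrow> tm \<Rightarrow> nat \<Rightarrow> 'a fm" where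
  "New_Eq u a b c d z =
     Or (And (Neg (Inside (Var 0) c d)) (Half_Eq u a b c d z))
        (And (Inside (Var 0) c d) (Ex z (And (Succ (Var 0) z) (Ex (z + 1) (Ex (z + 2)
           (And (Half_Eq u a (Var (z + 1)) c (Var 0) (z + 3))
           (And (And (Le (Var (z + 1)) (Var (z + 2))) (Inserted u (Var (z + 1)) (Var (z + 2)) (z + 3)))
                (Half_Eq u (Var (z + 2)) b (Var z) d (z + 3)))))))))"

lemma wf_fm_Half_Eq: "wf_fm (4 # ars) (Half_Eq u a b c d z)"
  by (simp add: Half_Eq_def)

lemma wf_fm_New_Eq: "wf_fm (4 # ars) (New_Eq u a b c d z)"
  by (simp add: New_Eq_def wf_fm_Half_Eq)

lemma fv_Half_Eq:
  "fv (Half_Eq u a b c d z) \<subseteq> insert 0 (fv_tm a \<union> fv_tm b \<union> fv_tm c \<union> fv_tm d)"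
  using fv_Inserted[of u "Var (z + 1)" "Var (z + 2)" "z + 3"] by (auto simp: Half_Eq_def)

lemma fv_New_Eq:
  "fv (New_Eq u a b c d z) \<subseteq> insert 0 (fv_tm a \<union> fv_tm b \<union> fv_tm c \<union> fv_tm d)"
  using fv_Inserted[of u "Var (z + 1)" "Var (z + 2)" "z + 3"] fv_Half_Eq[of u a b c d z]
    fv_Half_Eq[of u a "Var (z + 1)" c "Var 0" "z + 3"]
    fv_Half_Eq[of u "Var (z + 2)" b "Var z" d "z + 3"]
  by (auto simp: New_Eq_def)

section \<open>Correctness of the update formula for word equality\<close>

definition eq_relation :: "'a word_structure \<Rightarrow> nat list set" where
  "eq_relation W = {js \<in> tuples W 4. seg_eq W (js ! 0) (js ! 1) (js ! 2) (js ! 3)}"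

lemma in_eq_relation:
  "[a, b, c, d] \<in> eq_relation W \<longleftrightarrow> {a, b, c, d} \<subseteq> dom_of W \<and> seg_eq W a b c d"
  by (auto simp: eq_relation_def tuples_def numeral_3_eq_3)

text \<open>After cutting the first interval at \<open>e 0\<close>, no remaining piece on either
  side contains that position: the pieces of the second interval stay inside it, and
  \<open>out\<close> applies to them. The old relation is therefore still right on all
  pieces.\<close>

lemma sat_Half_Eq:
  assumes upd: "W' = apply_update u (e 0) W" "1 \<le> e 0" "e 0 \<le> extent W"
    and A: "A 0 = eq_relation W"
    and z: "0 < z" "max_var a < z" "max_var b < z" "max_var c < z" "max_var d < z"
    and dom: "eval_tm W' e a \<in> dom_of W" "eval_tm W' e b \<in> dom_of W"
      "eval_tm W' e c \<in> dom_of W" "eval_tm W' e d \<in> dom_of W"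
    and out: "\<not> (eval_tm W' e c \<le> e 0 \<and> e 0 < eval_tm W' e d)"
  shows "sat W' A e (Half_Eq u a b c d z) \<longleftrightarrow>
    seg_eq W' (eval_tm W' e a) (eval_tm W' e b) (eval_tm W' e c) (eval_tm W' e d)"
proof -
  define a' b' c' d' i where defs: "a' = eval_tm W' e a" "b' = eval_tm W' e b"
    "c' = eval_tm W' e c" "d' = eval_tm W' e d" "i = e 0"
  have domW: "dom_of W' = dom_of W"
    using upd by simp
  have i: "i \<in> dom_of W" "Suc i \<in> dom_of W"
    using upd by (auto simp: dom_of_def defs)
  note dom' = dom[folded defs] and out' = out[folded defs]
  have "sat W' A e (Half_Eq u a b c d z) \<longleftrightarrow>
     \<not> (a' \<le> i \<and> i < b') \<and> seg_eq W a' b' c' d' \<or>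
     (a' \<le> i \<and> i < b') \<and> (\<exists>c1 \<in> dom_of W. \<exists>c2 \<in> dom_of W.
       seg_eq W a' i c' c1 \<and> c1 \<le> c2 \<and> segment W' c1 c2 = inserted u \<and> seg_eq W (Suc i) b' c2 d')"
    using z i dom' domW unfolding Half_Eq_def
    by (simp add: A in_eq_relation not_less flip: defs cong: conj_cong disj_cong bex_cong)
  also have "\<dots> \<longleftrightarrow> seg_eq W' a' b' c' d'"
  proof (cases "a' \<le> i \<and> i < b'")
    case False
    then show ?thesis
      using out' upd(1) seg_eq_apply_update_outside[of a' i b' c' d' u W] by (simp flip: defs) blast
  next
    case True
    \<comment> \<open>The demand for non-degenerate intervals in \<open>seg_eq\<close> forces the
      cut points to lie in order between \<open>c'\<close> and \<open>d'\<close>; for any other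
      choice both sides are false.\<close>
    have "seg_eq W a' i c' c1 \<and> c1 \<le> c2 \<and> X \<and> seg_eq W (Suc i) b' c2 d' \<longleftrightarrow>
        seg_eq W' a' i c' c1 \<and> c1 \<le> c2 \<and> X \<and> seg_eq W' (Suc i) b' c2 d'" for c1 c2 X
    proof (cases "c' \<le> c1 \<and> c1 \<le> c2 \<and> c2 \<le> d'")
      case True
      then have "\<not> (c' \<le> i \<and> i < c1)" "\<not> (c2 \<le> i \<and> i < d')"
        using out' by auto
      then show ?thesis
        using upd(1) seg_eq_apply_update_outside[of a' i i c' c1 u W]
          seg_eq_apply_update_outside[of "Suc i" i b' c2 d' u W] by (auto simp flip: defs)
    qed (auto simp: seg_eq_def)
    moreover have "c1 \<in> dom_of W \<and> c2 \<in> dom_of W"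
      if "seg_eq W' a' i c' c1" "c1 \<le> c2" "seg_eq W' (Suc i) b' c2 d'" for c1 c2
      using that dom' by (auto simp: seg_eq_def dom_of_def)
    ultimately show ?thesis
      using True seg_eq_split_single[of a' i b' u W c' d'] upd(1) unfolding defs(5)[symmetric]
      by blast
  qed
  finally show ?thesis
    by (simp add: defs)
qed

text \<open>If the second interval contains the changed position, \<open>seg_eq_split_single\<close>
  is applied with the two intervals exchanged. The resulting pieces of the second interval avoid
  that position, so \<open>Half_Eq\<close> may be used for them. It starts its bound variables at
  \<open>z + 3\<close>, because \<open>z\<close>, \<open>z + 1\<close> and \<open>z + 2\<close> hold
  the successor and the two cut points.\<close>

lemma sat_New_Eq:
  assumes upd: "W' = apply_update u (e 0) W" "1 \<le> e 0" "e 0 \<le> extent W"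
    and A: "A 0 = eq_relation W"
    and z: "0 < z" "max_var a < z" "max_var b < z" "max_var c < z" "max_var d < z"
    and dom: "eval_tm W' e a \<in> dom_of W" "eval_tm W' e b \<in> dom_of W"
      "eval_tm W' e c \<in> dom_of W" "eval_tm W' e d \<in> dom_of W"
  shows "sat W' A e (New_Eq u a b c d z) \<longleftrightarrow>
    seg_eq W' (eval_tm W' e a) (eval_tm W' e b) (eval_tm W' e c) (eval_tm W' e d)"
proof -
  define a' b' c' d' i where defs: "a' = eval_tm W' e a" "b' = eval_tm W' e b"
    "c' = eval_tm W' e c" "d' = eval_tm W' e d" "i = e 0"
  have domW: "dom_of W' = dom_of W"
    using upd by simp
  have i: "i \<in> dom_of W" "Suc i \<in> dom_of W"
    using upd by (auto simp: dom_of_def defs)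
  note dom' = dom[folded defs]
  show ?thesis
  proof (cases "c' \<le> i \<and> i < d'")
    case False
    then show ?thesis
      using sat_Half_Eq[of W' u e W A z a b c d, OF upd A z dom]
      by (simp add: New_Eq_def defs) blast
  next
    case True
    have half: "sat W' A e' (Half_Eq u s t s' t' (z + 3)) \<longleftrightarrow>
        seg_eq W' (eval_tm W' e' s) (eval_tm W' e' t) (eval_tm W' e' s') (eval_tm W' e' t')"
      if "e' 0 = i" "max_var s < z + 3" "max_var t < z + 3" "max_var s' < z + 3" "max_var t' < z + 3"
        "eval_tm W' e' s \<in> dom_of W" "eval_tm W' e' t \<in> dom_of W"
        "eval_tm W' e' s' \<in> dom_of W" "eval_tm W' e' t' \<in> dom_of W"
        "\<not> (eval_tm W' e' s' \<le> i \<and> i < eval_tm W' e' t')" for e' s t s' t'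
      using that upd A by (intro sat_Half_Eq) (auto simp: defs)
    have "sat W' A e (New_Eq u a b c d z) \<longleftrightarrow>
      (\<exists>a1 \<in> dom_of W. \<exists>a2 \<in> dom_of W. seg_eq W' a' a1 c' i \<and> a1 \<le> a2 \<and>
         segment W' a1 a2 = inserted u \<and> seg_eq W' a2 b' (Suc i) d')"
      using z i dom' domW True unfolding New_Eq_def
      by (simp add: half not_less flip: defs cong: conj_cong disj_cong bex_cong)
    also have "\<dots> \<longleftrightarrow> seg_eq W' c' d' a' b'"
    proof -
      have "a1 \<in> dom_of W \<and> a2 \<in> dom_of W"
        if "seg_eq W' a' a1 c' i" "a1 \<le> a2" "seg_eq W' a2 b' (Suc i) d'" for a1 a2
        using that dom' by (auto simp: seg_eq_def dom_of_def)
      then show ?thesis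
        using True seg_eq_split_single[of c' i d' u W a' b'] upd(1) unfolding defs(5)[symmetric]
        by (metis seg_eq_commute)
    qed
    finally show ?thesis
      by (simp add: defs seg_eq_commute)
  qed
qed


section \<open>First-order closure of maintained relations\<close>

fun shift_tm :: "nat \<Rightarrow> tm \<Rightarrow> tm" where
  "shift_tm k (Var v) = Var (v + k)"
| "shift_tm k Dollar = Dollar"

text \<open>All variables, the bound ones included, are shifted by \<open>k\<close>, so that the parameters
  \<open>0, \<dots>, k - 1\<close> of the substituted formulas are not captured.\<close>

fun inst :: "nat \<Rightarrow> (nat \<Rightarrow> tm list \<Rightarrow> 'a fm) \<Rightarrow> 'a fm \<Rightarrow> 'a fm" where
  "inst k \<sigma> (Eq s t) = Eq (shift_tm k s) (shift_tm k t)"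
| "inst k \<sigma> (Less s t) = Less (shift_tm k s) (shift_tm k t)"
| "inst k \<sigma> (Lab \<zeta> t) = Lab \<zeta> (shift_tm k t)"
| "inst k \<sigma> (Aux r ts) = \<sigma> r (map (shift_tm k) ts)"
| "inst k \<sigma> (Neg \<phi>) = Neg (inst k \<sigma> \<phi>)"
| "inst k \<sigma> (And \<phi> \<psi>) = And (inst k \<sigma> \<phi>) (inst k \<sigma> \<psi>)"
| "inst k \<sigma> (Or \<phi> \<psi>) = Or (inst k \<sigma> \<phi>) (inst k \<sigma> \<psi>)"
| "inst k \<sigma> (Ex v \<phi>) = Ex (v + k) (inst k \<sigma> \<phi>)"
| "inst k \<sigma> (All v \<phi>) = All (v + k) (inst k \<sigma> \<phi>)"

lemma wf_fm_inst:
  assumes "\<And>r ts. r < length ars \<Longrightarrow> length ts = ars ! r \<Longrightarrow> wf_fm ars' (\<sigma> r ts)" "wf_fm ars \<phi>"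
  shows "wf_fm ars' (inst k \<sigma> \<phi>)"
  using assms(2) by (induction \<phi>) (auto intro: assms(1))

lemma fv_tm_shift_tm [simp]: "fv_tm (shift_tm k t) = (\<lambda>v. v + k) ` fv_tm t"
  by (cases t) auto

lemma fv_inst:
  assumes "\<And>r ts. r < length ars \<Longrightarrow> length ts = ars ! r \<Longrightarrow>
      fv (\<sigma> r ts) \<subseteq> {..<k} \<union> (\<Union>t \<in> set ts. fv_tm t)"
    and "wf_fm ars \<phi>"
  shows "fv (inst k \<sigma> \<phi>) \<subseteq> {..<k} \<union> (\<lambda>v. v + k) ` fv \<phi>"
  using assms(2)
proof (induction \<phi>)
  case (Aux r ts)
  then show ?case
    using assms(1)[of r "map (shift_tm k) ts"] by auto
qed auto

lemma eval_tm_shift_tm: "(\<And>v. e' (v + k) = e v) \<Longrightarrow> eval_tm W e' (shift_tm k t) = eval_tm W e t"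
  by (cases t) auto

lemma eval_tm_in_dom: "(\<And>v. v \<in> fv_tm t \<Longrightarrow> e v \<in> dom_of W) \<Longrightarrow> eval_tm W e t \<in> dom_of W"
  by (cases t) (auto simp: dollar_def dom_of_def)

text \<open>\<open>B\<close> interprets the original symbols and \<open>A\<close> those of the
  substituted formulas. For an update, \<open>B\<close> holds the new base relations,
  \<open>A\<close> the old ones, and \<open>p\<close> gives the updated position. The assumption on
  \<open>\<sigma>\<close> is limited to environments that agree with \<open>p\<close> below
  \<open>k\<close> and to arguments in the domain; the induction keeps this, since shifted binders
  are at least \<open>k\<close> and quantifiers range over the domain.\<close>

lemma sat_inst:
  assumes "\<And>r ts e. r < length ars \<Longrightarrow> length ts = ars ! r \<Longrightarrow> (\<And>j. j < k \<Longrightarrow> e j = p j) \<Longrightarrow>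
      (\<And>t. t \<in> set ts \<Longrightarrow> eval_tm W e t \<in> dom_of W) \<Longrightarrow>
      sat W A e (\<sigma> r ts) \<longleftrightarrow> map (eval_tm W e) ts \<in> B r"
    and "wf_fm ars \<phi>"
    and "\<And>v. v \<in> fv \<phi> \<Longrightarrow> e v \<in> dom_of W"
    and "\<And>v. e' (v + k) = e v" "\<And>j. j < k \<Longrightarrow> e' j = p j"
  shows "sat W A e' (inst k \<sigma> \<phi>) \<longleftrightarrow> sat W B e \<phi>"
  using assms(2-)
proof (induction \<phi> arbitrary: e e')
  case (Aux r ts)
  have ev: "eval_tm W e' (shift_tm k t) = eval_tm W e t" for t
    using Aux eval_tm_shift_tm by blast
  have "sat W A e' (\<sigma> r (map (shift_tm k) ts)) \<longleftrightarrow> map (eval_tm W e') (map (shift_tm k) ts) \<in> B r"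
  proof (rule assms(1))
    fix t
    assume "t \<in> set (map (shift_tm k) ts)"
    then obtain t' where "t' \<in> set ts" "t = shift_tm k t'"
      by auto
    moreover from this have "eval_tm W e t' \<in> dom_of W"
      using Aux.prems(2) by (auto intro!: eval_tm_in_dom)
    ultimately show "eval_tm W e' t \<in> dom_of W"
      by (simp add: ev)
  qed (use Aux.prems in auto)
  then show ?case
    by (simp add: ev comp_def)
next
  case (And \<phi> \<psi>)
  then show ?case
    by (simp add: And.IH[of e e'])
next
  case (Or \<phi> \<psi>)
  then show ?case
    by (simp add: Or.IH[of e e'])
next
  case (Ex v \<phi>)
  have "sat W A (e'(v + k := d)) (inst k \<sigma> \<phi>) \<longleftrightarrow> sat W B (e(v := d)) \<phi>" if "d \<in> dom_of W" for d
    using Ex.prems that by (intro Ex.IH) auto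
  then show ?case
    by simp
next
  case (All v \<phi>)
  have "sat W A (e'(v + k := d)) (inst k \<sigma> \<phi>) \<longleftrightarrow> sat W B (e(v := d)) \<phi>" if "d \<in> dom_of W" for d
    using All.prems that by (intro All.IH) auto
  then show ?case
    by simp
qed (auto simp: eval_tm_shift_tm)

lemma wf_fm_append: "wf_fm ars \<phi> \<Longrightarrow> wf_fm (ars @ ars') \<phi>"
  by (induction \<phi>) (auto simp: nth_append)

section \<open>Programs for relations defined from the base relations\<close>

definition defined_relation ::
    "('a word_structure \<Rightarrow> aux_state) \<Rightarrow> nat \<Rightarrow> 'a fm \<Rightarrow> 'a word_structure \<Rightarrow> nat list set" where
  "defined_relation base k \<psi> W = {js \<in> tuples W k. sat W (base W) (\<lambda>v. js ! v) \<psi>}"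

lemma tuples_apply_update [simp]: "tuples (apply_update u i W) k = tuples W k"
  by (simp add: tuples_def)

text \<open>The relation defined by \<open>\<psi>\<close> is updated by substituting the update formulas of the base relations
  for their symbols in \<open>\<psi>\<close>. The base relations are treated in the same way, via atomic \<open>\<psi>\<close>.\<close>

locale maintained_base =
  fixes ars :: "nat list"
    and base :: "'a::finite word_structure \<Rightarrow> aux_state"
    and ini :: "nat \<Rightarrow> tm list \<Rightarrow> 'a fm"
    and upd :: "'a abs_update \<Rightarrow> nat \<Rightarrow> tm list \<Rightarrow> 'a fm"
  assumes base_tuples: "r < length ars \<Longrightarrow> base W r \<subseteq> tuples W (ars ! r)"
    and wf_init: "r < length ars \<Longrightarrow> length ts = ars ! r \<Longrightarrow> wf_fm [] (ini r ts)"
    and fv_init: "r < length ars \<Longrightarrow> length ts = ars ! r \<Longrightarrow> fv (ini r ts) \<subseteq> (\<Union>t \<in> set ts. fv_tm t)"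
    and sat_init: "r < length ars \<Longrightarrow> length ts = ars ! r \<Longrightarrow> W = initial_structure n \<Longrightarrow>
      (\<And>t. t \<in> set ts \<Longrightarrow> eval_tm W e t \<in> dom_of W) \<Longrightarrow>
      sat W A e (ini r ts) \<longleftrightarrow> map (eval_tm W e) ts \<in> base W r"
    and wf_upd: "r < length ars \<Longrightarrow> length ts = ars ! r \<Longrightarrow> wf_fm ars (upd u r ts)"
    and fv_upd: "r < length ars \<Longrightarrow> length ts = ars ! r \<Longrightarrow>
      fv (upd u r ts) \<subseteq> insert 0 (\<Union>t \<in> set ts. fv_tm t)"
    and sat_upd: "r < length ars \<Longrightarrow> length ts = ars ! r \<Longrightarrow> W' = apply_update u (e 0) W \<Longrightarrow>
      1 \<le> e 0 \<Longrightarrow> e 0 \<le> extent W \<Longrightarrow> (\<And>r. r < length ars \<Longrightarrow> A r = base W r) \<Longrightarrow>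
      (\<And>t. t \<in> set ts \<Longrightarrow> eval_tm W' e t \<in> dom_of W') \<Longrightarrow>
      sat W' A e (upd u r ts) \<longleftrightarrow> map (eval_tm W' e) ts \<in> base W' r"
begin

definition definition_of :: "'a fm \<Rightarrow> nat \<Rightarrow> 'a fm" where
  "definition_of \<psi> r = (if r < length ars then Aux r (map Var [0..<ars ! r]) else \<psi>)"

text \<open>The target relation is the extra last symbol. The shift is \<open>0\<close> for
  initialization, which has no parameter, and \<open>1\<close> for updates, where variable
  \<open>0\<close> is the updated position and argument \<open>v\<close> of \<open>\<psi>\<close>
  becomes variable \<open>v + 1\<close>.\<close>

definition program :: "nat \<Rightarrow> 'a fm \<Rightarrow> 'a dyn_program" where
  "program k \<psi> =
     \<lparr>aux_arities = ars @ [k],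
      init_fm = (\<lambda>r. inst 0 ini (definition_of \<psi> r)),
      update_fm = (\<lambda>u r. inst 1 (upd u) (definition_of \<psi> r))\<rparr>"

lemma defined_relation_base:
  assumes "r < length ars"
  shows "defined_relation base (ars ! r) (definition_of \<psi> r) W = base W r"
proof -
  have "map (eval_tm W ((!) js)) (map Var [0..<ars ! r]) = js" if "length js = ars ! r" for js
    using map_nth[of js] that by (simp add: comp_def)
  then show ?thesis
    using assms base_tuples[OF assms, of W]
    by (auto simp: defined_relation_def definition_of_def tuples_def simp del: map_map)
qed

context
  fixes \<psi> :: "'a fm" and k :: nat
  assumes wf: "wf_fm ars \<psi>" and fv: "fv \<psi> \<subseteq> {..<k}"
begin

lemma wf_definition_of: "wf_fm ars (definition_of \<psi> r)"
  using wf by (simp add: definition_of_def)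

lemma fv_definition_of: "r < Suc (length ars) \<Longrightarrow> fv (definition_of \<psi> r) \<subseteq> {..<(ars @ [k]) ! r}"
  using fv by (auto simp: definition_of_def nth_append)

lemma wf_program: "wf_program (program k \<psi>)"
  unfolding wf_program_def
proof (intro allI impI conjI)
  fix r u
  assume "r < length (aux_arities (program k \<psi>))"
  then have r: "r < Suc (length ars)"
    by (simp add: program_def)
  show "wf_fm [] (init_fm (program k \<psi>) r)"
    using wf_fm_inst[of ars "[]" ini, OF wf_init wf_definition_of] by (simp add: program_def)
  show "fv (init_fm (program k \<psi>) r) \<subseteq> {..<aux_arities (program k \<psi>) ! r}"
    using fv_inst[of ars ini 0, OF _ wf_definition_of[of r]] fv_init fv_definition_of[OF r]
    by (fastforce simp: program_def)
  show "wf_fm (aux_arities (program k \<psi>)) (update_fm (program k \<psi>) u r)"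
    using wf_fm_inst[of ars ars "upd u", OF wf_upd wf_definition_of]
    by (simp add: program_def wf_fm_append)
  have "fv (inst 1 (upd u) (definition_of \<psi> r)) \<subseteq> {..<1} \<union> (\<lambda>v. v + 1) ` fv (definition_of \<psi> r)"
    by (rule fv_inst[of ars]) (use fv_upd wf_definition_of in auto)
  then show "fv (update_fm (program k \<psi>) u r) \<subseteq> {..aux_arities (program k \<psi>) ! r}"
    using fv_definition_of[OF r] by (fastforce simp: program_def)
qed

lemma reachable_program:
  assumes "reachable (program k \<psi>) W A" "r < Suc (length ars)"
  shows "A r = defined_relation base ((ars @ [k]) ! r) (definition_of \<psi> r) W"
  using assms
proof (induction arbitrary: r)
  case (init n)
  let ?W = "initial_structure n :: 'a word_structure"
  have "sat ?W (\<lambda>_. {}) ((!) js) (inst 0 ini (definition_of \<psi> r)) \<longleftrightarrow>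
      sat ?W (base ?W) ((!) js) (definition_of \<psi> r)" if "js \<in> tuples ?W ((ars @ [k]) ! r)" for js
  proof (rule sat_inst[of ars 0 undefined, OF _ wf_definition_of])
    show "js ! v \<in> dom_of ?W" if "v \<in> fv (definition_of \<psi> r)" for v
    proof -
      have "v < length js"
        using that fv_definition_of[OF init] \<open>js \<in> _\<close> by (auto simp: tuples_def)
      then show ?thesis
        using \<open>js \<in> _\<close> nth_mem by (auto simp: tuples_def)
    qed
  qed (use sat_init[OF _ _ refl] in simp_all)
  then show ?case
    by (auto simp: initial_aux_def defined_relation_def program_def)
next
  case (step W A u i)
  let ?W = "apply_update u i W"
  \<comment> \<open>The induction hypothesis is used for base symbols only: the new target relation
    is computed from the old base relations, not from its own old value.\<close>
  have A: "A r = base W r" if "r < length ars" for r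
    using step.IH[of r] that defined_relation_base[OF that] by (simp add: nth_append)
  have i: "1 \<le> i" "i \<le> extent W"
    using step.hyps by (auto simp: allowed_update_def)
  have "sat ?W A ((!) (i # js)) (inst 1 (upd u) (definition_of \<psi> r)) \<longleftrightarrow>
      sat ?W (base ?W) ((!) js) (definition_of \<psi> r)" if "js \<in> tuples ?W ((ars @ [k]) ! r)" for js
  proof (rule sat_inst[of ars 1 "\<lambda>_. i", OF _ wf_definition_of])
    show "sat ?W A e (upd u r' ts) \<longleftrightarrow> map (eval_tm ?W e) ts \<in> base ?W r'"
      if "r' < length ars" "length ts = ars ! r'" "\<And>j. j < 1 \<Longrightarrow> e j = i"
        "\<And>t. t \<in> set ts \<Longrightarrow> eval_tm ?W e t \<in> dom_of ?W" for r' ts e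
      using that i A by (intro sat_upd) auto
    show "js ! v \<in> dom_of ?W" if "v \<in> fv (definition_of \<psi> r)" for v
    proof -
      have "v < length js"
        using that fv_definition_of[OF step.prems] \<open>js \<in> _\<close> by (auto simp: tuples_def)
      then show ?thesis
        using \<open>js \<in> _\<close> nth_mem by (auto simp: tuples_def)
    qed
  qed auto
  then show ?case
    by (auto simp: updated_aux_def defined_relation_def program_def)
qed

theorem defined_relation_in_DynFO: "defined_relation base k \<psi> \<in> DynFO k"
proof -
  have "maintains (program k \<psi>) (length ars) (defined_relation base k \<psi>)"
    using reachable_program[of _ _ "length ars"] by (simp add: maintains_def definition_of_def)
  then show ?thesis
    using wf_program unfolding DynFO_def
    by (auto simp: program_def intro!: exI[of _ "program k \<psi>"] exI[of _ "length ars"])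
qed

end

end


section \<open>The base relations\<close>

definition state_pairs :: "'s list \<Rightarrow> ('s \<times> 's) list" where
  "state_pairs qs = List.product qs qs"

text \<open>Symbol \<open>0\<close> is word equality; symbol \<open>Suc j\<close> is the run
  relation of the \<open>j\<close>-th pair of states.\<close>

definition base_arities :: "'s list \<Rightarrow> nat list" where
  "base_arities qs = 4 # replicate (length (state_pairs qs)) 2"

text \<open>Repetitions in \<open>qs\<close> are harmless: whichever index is chosen, the pair
  stored there is the intended one.\<close>

definition run_symbol :: "'s list \<Rightarrow> 's \<Rightarrow> 's \<Rightarrow> nat" where
  "run_symbol qs K K' = Suc (SOME j. j < length (state_pairs qs) \<and> state_pairs qs ! j = (K, K'))"

lemma run_symbol:
  assumes "K \<in> set qs" "K' \<in> set qs"
  shows "run_symbol qs K K' \<noteq> 0" "run_symbol qs K K' < length (base_arities qs)"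
    "base_arities qs ! run_symbol qs K K' = 2"
    "state_pairs qs ! (run_symbol qs K K' - 1) = (K, K')"
proof -
  have "\<exists>j. j < length (state_pairs qs) \<and> state_pairs qs ! j = (K, K')"
    using assms unfolding in_set_conv_nth[symmetric] by (simp add: state_pairs_def)
  from someI_ex[OF this] show "run_symbol qs K K' \<noteq> 0"
    "run_symbol qs K K' < length (base_arities qs)"
    "base_arities qs ! run_symbol qs K K' = 2"
    "state_pairs qs ! (run_symbol qs K K' - 1) = (K, K')"
    by (simp_all add: run_symbol_def base_arities_def)
qed

text \<open>For a fixed first state this is the graph of a function of the interval, by determinism.
  Reversed intervals carry the empty word and lead from a state to itself, so order has to be tested
  elsewhere.\<close>

definition run_relation ::
    "('a, 'v) refsym list set \<times> ('a, 'v) refsym list set \<Rightarrow> 'a word_structure \<Rightarrow> nat list set" where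
  "run_relation KK W =
     {js \<in> tuples W 2. left_quotient (map Letter (segment W (js ! 0) (js ! 1))) (fst KK) = snd KK}"

lemma in_run_relation:
  "[a, b] \<in> run_relation (K, K') W \<longleftrightarrow>
     {a, b} \<subseteq> dom_of W \<and> left_quotient (map Letter (segment W a b)) K = K'"
  by (auto simp: run_relation_def tuples_def)

definition base_relations ::
    "('a, 'v) refsym list set list \<Rightarrow> 'a word_structure \<Rightarrow> aux_state" where
  "base_relations qs W r = (if r = 0 then eq_relation W else run_relation (state_pairs qs ! (r - 1)) W)"

text \<open>\<open>K1\<close> is the state reached just before the changed position. The letter put
  there is read by taking a quotient at the level of states, so both remaining runs use old
  relations on intervals without that position.\<close>

definition New_Run ::
    "('a::finite, 'v) refsym list set list \<Rightarrow> 'a abs_update \<Rightarrow> ('a, 'v) refsym list set \<Rightarrow>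
       ('a, 'v) refsym list set \<Rightarrow> tm \<Rightarrow> tm \<Rightarrow> nat \<Rightarrow> 'a fm" where
  "New_Run qs u K K' a b z =
     Or (And (Neg (Inside (Var 0) a b)) (Aux (run_symbol qs K K') [a, b]))
        (And (Inside (Var 0) a b) (Ex z (And (Succ (Var 0) z)
           (disj (map (\<lambda>K1. And (Aux (run_symbol qs K K1) [a, Var 0])
             (Aux (run_symbol qs (left_quotient (map Letter (inserted u)) K1) K') [Var z, b])) qs)))))"

text \<open>A sum of natural numbers bounds each summand, so \<open>z\<close> exceeds all argument
  variables. Being positive, it also leaves variable \<open>0\<close>, the updated position,
  free.\<close>

definition base_update ::
    "('a::finite, 'v) refsym list set list \<Rightarrow> 'a abs_update \<Rightarrow> nat \<Rightarrow> tm list \<Rightarrow> 'a fm" where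
  "base_update qs u r ts =
     (let z = Suc (sum_list (map max_var ts)) in
      if r = 0 then New_Eq u (ts ! 0) (ts ! 1) (ts ! 2) (ts ! 3) z
      else New_Run qs u (fst (state_pairs qs ! (r - 1))) (snd (state_pairs qs ! (r - 1))) (ts ! 0) (ts ! 1) z)"

text \<open>Initially all segments are empty: equality reduces to non-degeneracy, and a run stays in
  its state.\<close>

definition base_init :: "('a::finite, 'v) refsym list set list \<Rightarrow> nat \<Rightarrow> tm list \<Rightarrow> 'a fm" where
  "base_init qs r ts =
     (if r = 0 then And (Le (ts ! 0) (ts ! 1)) (Le (ts ! 2) (ts ! 3))
      else if fst (state_pairs qs ! (r - 1)) = snd (state_pairs qs ! (r - 1)) then Eq Dollar Dollar
      else Neg (Eq Dollar Dollar))"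

text \<open>\<open>c\<close> ranges over all ref-symbols, as \<open>Path\<close> leaves a state by a
  marker too.\<close>

locale quotient_states =
  fixes qs :: "('a::finite, 'v) refsym list set list"
  assumes quotient_closed: "K \<in> set qs \<Longrightarrow> left_quotient [c] K \<in> set qs"
begin

lemma quotient_in_states: "K \<in> set qs \<Longrightarrow> left_quotient w K \<in> set qs"
proof (induction w rule: rev_induct)
  case (snoc c w)
  then show ?case
    using quotient_closed by (simp add: left_quotient_append)
qed simp

lemma base_relations_run_symbol:
  "K \<in> set qs \<Longrightarrow> K' \<in> set qs \<Longrightarrow> base_relations qs W (run_symbol qs K K') = run_relation (K, K') W"
  using run_symbol[of K qs K'] by (simp add: base_relations_def)

lemma sat_New_Run:
  assumes upd: "W' = apply_update u (e 0) W" "1 \<le> e 0" "e 0 \<le> extent W"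
    and A: "\<And>r. r < length (base_arities qs) \<Longrightarrow> A r = base_relations qs W r"
    and z: "0 < z" "max_var a < z" "max_var b < z"
    and dom: "eval_tm W' e a \<in> dom_of W" "eval_tm W' e b \<in> dom_of W"
    and K: "K \<in> set qs" "K' \<in> set qs"
  shows "sat W' A e (New_Run qs u K K' a b z) \<longleftrightarrow>
    left_quotient (map Letter (segment W' (eval_tm W' e a) (eval_tm W' e b))) K = K'"
proof -
  define a' b' i where defs: "a' = eval_tm W' e a" "b' = eval_tm W' e b" "i = e 0"
  have domW: "dom_of W' = dom_of W"
    using upd by simp
  have i: "i \<in> dom_of W" "Suc i \<in> dom_of W"
    using upd by (auto simp: dom_of_def defs)
  note dom' = dom[folded defs]
  have A': "A (run_symbol qs K K') = run_relation (K, K') W" if "K \<in> set qs" "K' \<in> set qs" for K K'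
    using that A base_relations_run_symbol run_symbol(2) by metis
  show ?thesis
  proof (cases "a' \<le> i \<and> i < b'")
    case False
    then have "sat W' A e (New_Run qs u K K' a b z) \<longleftrightarrow> left_quotient (map Letter (segment W a' b')) K = K'"
      using dom' K unfolding New_Run_def by (simp add: A' in_run_relation flip: defs) blast
    then show ?thesis
      using False upd(1) segment_apply_update_outside[of a' i b' u W] by (simp add: defs)
  next
    case True
    then have "sat W' A e (New_Run qs u K K' a b z) \<longleftrightarrow>
       (\<exists>K1 \<in> set qs. left_quotient (map Letter (segment W a' i)) K = K1 \<and>
          left_quotient (map Letter (segment W (Suc i) b')) (left_quotient (map Letter (inserted u)) K1) = K')"
      using z i dom' domW K unfolding New_Run_def
      by (simp add: A' quotient_in_states in_run_relation flip: defs cong: conj_cong disj_cong bex_cong)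
    also have "\<dots> \<longleftrightarrow> left_quotient (map Letter (segment W' a' b')) K = K'"
      using True K upd(1) quotient_in_states segment_apply_update_inside[of a' i b' u W]
      by (simp add: left_quotient_append flip: defs)
    finally show ?thesis
      by (simp add: defs)
  qed
qed

lemma base_cases:
  assumes "r < length (base_arities qs)"
  obtains "r = 0" "base_arities qs ! r = 4"
  | K K' where "r \<noteq> 0" "base_arities qs ! r = 2" "K \<in> set qs" "K' \<in> set qs"
      "state_pairs qs ! (r - 1) = (K, K')"
proof (cases r)
  case 0
  then show ?thesis
    using that by (simp add: base_arities_def)
next
  case (Suc j)
  then have "state_pairs qs ! j \<in> set (state_pairs qs)"
    using assms by (intro nth_mem) (simp add: base_arities_def)
  then obtain K K' where "state_pairs qs ! j = (K, K')" "K \<in> set qs" "K' \<in> set qs"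
    by (auto simp: state_pairs_def)
  then show ?thesis
    using that(2)[of K K'] Suc assms by (simp add: base_arities_def)
qed

context
  fixes r :: nat and ts :: "tm list"
  assumes r: "r < length (base_arities qs)" and len: "length ts = base_arities qs ! r"
begin

lemma fv_base_init: "fv (base_init qs r ts) \<subseteq> (\<Union>t \<in> set ts. fv_tm t)"
  using len by (cases rule: base_cases[OF r]) (auto simp: base_init_def intro!: bexI[OF _ nth_mem])

lemma wf_base_update: "wf_fm (base_arities qs) (base_update qs u r ts)"
proof (cases rule: base_cases[OF r])
  case 1
  then show ?thesis
    by (simp add: base_update_def Let_def wf_fm_New_Eq base_arities_def)
next
  case 2
  then show ?thesis
    using run_symbol(2,3)[of _ qs] quotient_in_states
    by (simp add: base_update_def Let_def New_Run_def numeral_2_eq_2)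
qed

lemma fv_base_update: "fv (base_update qs u r ts) \<subseteq> insert 0 (\<Union>t \<in> set ts. fv_tm t)"
proof -
  have fv_nth: "fv_tm (ts ! j) \<subseteq> (\<Union>t \<in> set ts. fv_tm t)" if "j < length ts" for j
    using that by (intro UN_upper) simp
  show ?thesis
  proof (cases rule: base_cases[OF r])
    case 1
    then show ?thesis
      using len fv_nth unfolding base_update_def Let_def
      by simp (rule subset_trans[OF fv_New_Eq], intro insert_mono Un_least, simp_all)
  next
    case 2
    then show ?thesis
      using len fv_nth[of 0] fv_nth[of 1] by (auto simp: base_update_def Let_def New_Run_def)
  qed
qed

lemma sat_base_init:
  assumes "W = initial_structure n" "\<And>t. t \<in> set ts \<Longrightarrow> eval_tm W e t \<in> dom_of W"
  shows "sat W A e (base_init qs r ts) \<longleftrightarrow> map (eval_tm W e) ts \<in> base_relations qs W r"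
proof -
  have "map (eval_tm W e) ts \<in> tuples W (length ts)"
    using assms(2) by (auto simp: tuples_def)
  moreover have "segment W a b = []" for a b
    using assms(1) by simp
  ultimately show ?thesis
    using len by (cases rule: base_cases[OF r])
      (auto simp: base_init_def base_relations_def eq_relation_def run_relation_def seg_eq_def)
qed

lemma sat_base_update:
  assumes upd: "W' = apply_update u (e 0) W" "1 \<le> e 0" "e 0 \<le> extent W"
    and A: "\<And>r. r < length (base_arities qs) \<Longrightarrow> A r = base_relations qs W r"
    and "\<And>t. t \<in> set ts \<Longrightarrow> eval_tm W' e t \<in> dom_of W'"
  shows "sat W' A e (base_update qs u r ts) \<longleftrightarrow> map (eval_tm W' e) ts \<in> base_relations qs W' r"
proof -
  have max_nth: "max_var (ts ! j) < Suc (sum_list (map max_var ts))" if "j < length ts" for j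
    using that by (simp add: less_Suc_eq_le member_le_sum_list)
  have dom: "eval_tm W' e (ts ! j) \<in> dom_of W" if "j < length ts" for j
    using that upd assms(5)[of "ts ! j"] by simp
  have tup: "map (eval_tm W' e) ts \<in> tuples W' (length ts)"
    using assms(5) by (auto simp: tuples_def)
  have A0: "A 0 = eq_relation W"
    using A[of 0] by (simp add: base_arities_def base_relations_def)
  show ?thesis
  proof (cases rule: base_cases[OF r])
    case 1
    have "sat W' A e (New_Eq u (ts ! 0) (ts ! 1) (ts ! 2) (ts ! 3) (Suc (sum_list (map max_var ts)))) \<longleftrightarrow>
        seg_eq W' (eval_tm W' e (ts ! 0)) (eval_tm W' e (ts ! 1)) (eval_tm W' e (ts ! 2)) (eval_tm W' e (ts ! 3))"
      using 1 len by (intro sat_New_Eq[of W' u e W A, OF upd A0] max_nth dom) simp_all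
    then show ?thesis
      using 1 len tup by (simp add: base_update_def base_relations_def eq_relation_def)
  next
    case (2 K K')
    have "sat W' A e (New_Run qs u K K' (ts ! 0) (ts ! 1) (Suc (sum_list (map max_var ts)))) \<longleftrightarrow>
        left_quotient (map Letter (segment W' (eval_tm W' e (ts ! 0)) (eval_tm W' e (ts ! 1)))) K = K'"
      using 2 len by (intro sat_New_Run[of W' u e W A, OF upd A] max_nth dom) simp_all
    then show ?thesis
      using 2 len tup by (simp add: base_update_def base_relations_def run_relation_def)
  qed
qed

end

sublocale maintained_base "base_arities qs" "base_relations qs" "base_init qs" "base_update qs"
proof
  show "base_relations qs W r \<subseteq> tuples W (base_arities qs ! r)" if "r < length (base_arities qs)" for W r
    by (cases rule: base_cases[OF that]) (auto simp: base_relations_def eq_relation_def run_relation_def)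
  show "wf_fm [] (base_init qs r ts)" for r ts
    by (simp add: base_init_def)
qed (fact fv_base_init sat_base_init wf_base_update fv_base_update sat_base_update)+

end


section \<open>Positions and endpoints\<close>

text \<open>This is \<open>pos\<close> on symbol-elements and the length of the word plus one at the
  last position, but it makes sense at blank positions as well.\<close>

definition rank :: "'a word_structure \<Rightarrow> nat \<Rightarrow> nat" where
  "rank W d = Suc (length (segment W 1 d))"

definition endpoint :: "'a word_structure \<Rightarrow> nat \<Rightarrow> bool" where
  "endpoint W d \<longleftrightarrow> symbol_element W d \<or> d = dollar W"

lemma length_segment: "length (segment W a b) = card {i. a \<le> i \<and> i < b \<and> label W i \<noteq> None}"
  by (auto simp: segment_def List.map_filter_def distinct_length_filter intro!: arg_cong[of _ _ card])

lemma pos_eq_rank: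
  assumes "symbol_element W d"
  shows "pos W d = rank W d"
proof -
  have "{i. symbol_element W i \<and> i \<le> d} = {i. 1 \<le> i \<and> i < Suc d \<and> label W i \<noteq> None}"
    using assms by (auto simp: symbol_element_def)
  then have "pos W d = length (segment W 1 (Suc d))"
    by (simp only: pos_def length_segment)
  moreover obtain \<zeta> where "1 \<le> d" "label W d = Some \<zeta>"
    using assms by (auto simp: symbol_element_def)
  ultimately show ?thesis
    using segment_symbol[of 1 d "Suc d" W \<zeta>] by (simp add: rank_def)
qed

lemma represents_iff: "represents W d m \<longleftrightarrow> endpoint W d \<and> m = rank W d"
proof -
  have "length (word_of W) + 1 = rank W (dollar W)"
    by (simp add: word_of_segment rank_def)
  then show ?thesis
    using pos_eq_rank[of W d] by (auto simp: represents_def endpoint_def)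
qed

lemma endpoint_in_dom: "endpoint W d \<Longrightarrow> d \<in> dom_of W"
  by (auto simp: endpoint_def symbol_element_def dom_of_def dollar_def)

text \<open>A symbol-element contributes a letter itself, so every later position has strictly
  larger rank. For blank \<open>d\<close> this fails, as the next position has the same
  rank.\<close>

lemma le_if_rank_le:
  assumes "endpoint W d" "a \<le> dollar W" "rank W a \<le> rank W d"
  shows "a \<le> d"
proof (rule ccontr)
  assume "\<not> a \<le> d"
  with assms have "symbol_element W d" "d < a"
    by (auto simp: endpoint_def)
  then obtain \<zeta> where "1 \<le> d" "label W d = Some \<zeta>"
    by (auto simp: symbol_element_def)
  then show False
    using assms(3) \<open>d < a\<close> segment_symbol[of 1 d a W \<zeta>] by (simp add: rank_def)
qed

lemma rank_surj:
  assumes "1 \<le> m" "m \<le> length (word_of W) + 1"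
  shows "\<exists>d. endpoint W d \<and> rank W d = m"
proof (cases "m = length (word_of W) + 1")
  case True
  then show ?thesis
    by (intro exI[of _ "dollar W"]) (simp add: endpoint_def rank_def word_of_segment)
next
  case False
  let ?w = "word_of W"
  have "segment W 1 (dollar W) = take (m - 1) ?w @ drop (m - 1) ?w" "1 \<le> dollar W"
    by (simp_all add: word_of_segment dollar_def)
  then obtain p where p: "1 \<le> p" "p \<le> dollar W" "segment W 1 p = take (m - 1) ?w"
      "segment W p (dollar W) = drop (m - 1) ?w"
    using segment_split by meson
  \<comment> \<open>The cut \<open>p\<close> has the right rank but may be blank; moving on to the
    first labelled position skips no letter.\<close>
  define j where "j = (LEAST j. p \<le> j \<and> j < dollar W \<and> label W j \<noteq> None)"
  have "segment W p (dollar W) \<noteq> []"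
    using p False assms by simp
  then have "\<exists>j. p \<le> j \<and> j < dollar W \<and> label W j \<noteq> None"
    by (auto simp: segment_eq_Nil_iff)
  then have j: "p \<le> j" "j < dollar W" "label W j \<noteq> None"
    unfolding j_def by (metis (mono_tags, lifting) LeastI_ex)+
  have "segment W p j = []"
    using not_less_Least[of _ "\<lambda>j. p \<le> j \<and> j < dollar W \<and> label W j \<noteq> None", folded j_def] j
    by (auto simp: segment_eq_Nil_iff)
  then have "rank W j = m"
    using p j assms segment_append[of 1 p j W] by (simp add: rank_def)
  moreover have "endpoint W j"
    using p j by (auto simp: endpoint_def symbol_element_def dollar_def)
  ultimately show ?thesis
    by blast
qed

lemma word_of_split:
  assumes "a \<in> dom_of W" "b \<in> dom_of W" "a \<le> b"
  shows "word_of W = segment W 1 a @ segment W a b @ segment W b (dollar W)"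
  using assms segment_append[of 1 a "dollar W" W] segment_append[of a b "dollar W" W]
  by (simp add: word_of_segment dom_of_def dollar_def)

lemma factor_rank:
  assumes "a \<in> dom_of W" "b \<in> dom_of W" "a \<le> b"
  shows "factor (word_of W) (rank W a, rank W b) = segment W a b"
proof -
  have "segment W 1 b = segment W 1 a @ segment W a b"
    using assms by (intro segment_append) (auto simp: dom_of_def)
  then show ?thesis
    using word_of_split[OF assms] by (simp add: rank_def)
qed


section \<open>Ref-words of functional regex formulas\<close>

lemma clear_append [simp]: "clear (r @ s) = clear r @ clear s"
  by (induction r rule: clear.induct) auto

lemma clear_map_Letter [simp]: "clear (map Letter u) = u"
  by (induction u) auto

fun is_marker :: "('a, 'v) refsym \<Rightarrow> bool" where
  "is_marker (Letter a) = False"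
| "is_marker (Opening x) = True"
| "is_marker (Closing x) = True"

definition markers :: "'v set \<Rightarrow> ('a, 'v) refsym set" where
  "markers V = Opening ` V \<union> Closing ` V"

lemma is_marker_markers: "m \<in> markers V \<Longrightarrow> is_marker m"
  by (auto simp: markers_def)

lemma clear_marker [simp]: "is_marker m \<Longrightarrow> clear (m # r) = clear r"
  by (cases m) auto

lemma map_Letter_clear: "\<forall>y \<in> set r. \<not> is_marker y \<Longrightarrow> map Letter (clear r) = r"
  by (induction r rule: clear.induct) auto

lemma finite_rvars [simp]: "finite (rvars \<alpha>)"
  by (induction \<alpha>) auto

lemma ref_words_markers:
  "r \<in> ref_words \<alpha> \<Longrightarrow> m \<in> set r \<Longrightarrow> is_marker m \<Longrightarrow> m \<in> markers (rvars \<alpha>)"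
proof (induction \<alpha> arbitrary: r)
  case (Star \<alpha>)
  then obtain rs s where "set rs \<subseteq> ref_words \<alpha>" "s \<in> set rs" "m \<in> set s"
    by auto
  then show ?case
    using Star.IH[of s] Star.prems(3) by auto
next
  case (Conc \<alpha> \<beta>)
  then show ?case
    by (fastforce simp: markers_def)
next
  case (Capture x \<alpha>)
  then show ?case
    by (fastforce simp: markers_def)
next
  case (Alt \<alpha> \<beta>)
  then show ?case
    by (fastforce simp: markers_def)
qed auto

text \<open>\<open>functional\<close> restricts opening markers only. Captures generate markers in
  pairs, which transfers the restriction to closing markers.\<close>

lemma count_Closing_eq_Opening:
  "r \<in> ref_words \<alpha> \<Longrightarrow> count_list r (Closing x) = count_list r (Opening x)"
proof (induction \<alpha> arbitrary: r)
  case (Star \<alpha>)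
  then obtain rs where "r = concat rs" "set rs \<subseteq> ref_words \<alpha>"
    by auto
  moreover from this(2) have "count_list (concat rs) (Closing x) = count_list (concat rs) (Opening x)"
    using Star.IH by (induction rs) auto
  ultimately show ?case
    by simp
next
  case (Capture y \<alpha>)
  then show ?case
    by auto
qed auto

lemma functional_count:
  assumes "functional \<alpha>" "r \<in> ref_words \<alpha>" "m \<in> markers (rvars \<alpha>)"
  shows "count_list r m = 1"
  using assms count_Closing_eq_Opening[OF assms(2)] by (auto simp: functional_def markers_def)

lemma append_Cons_unique:
  assumes "r1 @ m # r2 = s1 @ m # s2" "count_list (r1 @ m # r2) m = 1"
  shows "r1 = s1"
proof -
  have "m \<notin> set r1" "m \<notin> set r2"
    using assms(2) by (auto simp: count_list_0_iff)
  then show ?thesis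
    using assms(1) append_Cons_eq_iff by metis
qed

lemma count_list_filter: "P x \<Longrightarrow> count_list (filter P r) x = count_list r x"
  by (induction r) auto

lemma distinct_if_count_le_1: "(\<And>x. count_list r x \<le> 1) \<Longrightarrow> distinct r"
proof (induction r)
  case (Cons y r)
  have "count_list r x \<le> 1" for x
    using Cons.prems[of x] by (auto split: if_splits)
  moreover have "count_list r y = 0"
    using Cons.prems[of y] by simp
  ultimately show ?case
    using Cons.IH by (simp add: count_list_0_iff)
qed simp

text \<open>The ref-word in which the markers \<open>ms\<close> are inserted, in this order, right before the positions
  that \<open>p\<close> assigns to them.\<close>

fun place :: "'a word_structure \<Rightarrow> (('a, 'v) refsym \<Rightarrow> nat) \<Rightarrow> nat \<Rightarrow> ('a, 'v) refsym list \<Rightarrow>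
    ('a, 'v) refsym list" where
  "place W p a [] = map Letter (segment W a (dollar W))"
| "place W p a (m # ms) = map Letter (segment W a (p m)) @ m # place W p (p m) ms"

text \<open>The inequality is weak, as several markers may stand at the same position; their order
  is then recorded only by the list.\<close>

fun chain :: "('m \<Rightarrow> nat) \<Rightarrow> nat \<Rightarrow> 'm list \<Rightarrow> bool" where
  "chain p a [] \<longleftrightarrow> True"
| "chain p a (m # ms) \<longleftrightarrow> a \<le> p m \<and> chain p (p m) ms"

lemma chain_append: "chain p a (ms @ m # ms') \<Longrightarrow> a \<le> p m \<and> chain p (p m) ms'"
  by (induction ms arbitrary: a) (auto intro: le_trans)

lemma clear_place:
  "chain p a ms \<Longrightarrow> a \<le> dollar W \<Longrightarrow> \<forall>m \<in> set ms. is_marker m \<and> p m \<le> dollar W \<Longrightarrow>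
    clear (place W p a ms) = segment W a (dollar W)"
  by (induction ms arbitrary: a) (auto simp: segment_append[symmetric])

lemma place_append:
  assumes "chain p a (ms @ m # ms')" "\<forall>m \<in> set ms. is_marker m"
  shows "\<exists>X. place W p a (ms @ m # ms') = X @ m # place W p (p m) ms' \<and> clear X = segment W a (p m)"
  using assms
proof (induction ms arbitrary: a)
  case (Cons m1 ms)
  then obtain X where "place W p (p m1) (ms @ m # ms') = X @ m # place W p (p m) ms'"
      "clear X = segment W (p m1) (p m)"
    by auto
  then show ?case
    using Cons.prems chain_append[of p "p m1" ms m ms'] segment_append[of a "p m1" "p m" W]
    by (intro exI[of _ "map Letter (segment W a (p m1)) @ m1 # X"]) auto
qed auto

text \<open>A ref-word is recovered from its sequence of markers and their positions. Up to the
  first marker \<open>m\<close>, the letters of \<open>r\<close> and the segment from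
  \<open>a\<close> to \<open>p m\<close> are prefixes of the same word; the ranks give them equal
  length, hence they coincide. The rest follows by induction with \<open>p m\<close> in place of
  \<open>a\<close>.\<close>

lemma place_filter_is_marker:
  assumes "\<And>r1 m r2. r = r1 @ m # r2 \<Longrightarrow> is_marker m \<Longrightarrow>
      endpoint W (p m) \<and> rank W (p m) = rank W a + length (clear r1)"
    and "1 \<le> a" "a \<le> dollar W" "clear r = segment W a (dollar W)"
  shows "chain p a (filter is_marker r) \<and> place W p a (filter is_marker r) = r"
  using assms
proof (induction "length r" arbitrary: r a rule: less_induct)
  case less
  show ?case
  proof (cases "\<exists>m \<in> set r. is_marker m")
    case False
    then show ?thesis
      using map_Letter_clear[of r] less.prems(4) by (simp add: filter_empty_conv)
  next
    case True
    then obtain us m r' where r: "r = us @ m # r'" "is_marker m" "\<forall>y \<in> set us. \<not> is_marker y"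
      using split_list_first_prop by (metis (no_types, lifting))
    have us: "map Letter (clear us) = us" "filter is_marker us = []"
      using r map_Letter_clear by (auto simp: filter_empty_conv)
    have m: "endpoint W (p m)" "rank W (p m) = rank W a + length (clear us)"
      using less.prems(1) r by auto
    then have le: "a \<le> p m"
      using le_if_rank_le[of W "p m" a] less.prems(3) by simp
    have dom: "1 \<le> p m" "p m \<le> dollar W"
      using endpoint_in_dom[OF m(1)] by (auto simp: dom_of_def dollar_def)
    have seg: "segment W a (dollar W) = segment W a (p m) @ segment W (p m) (dollar W)"
      using le dom by (intro segment_append)
    have "segment W 1 (p m) = segment W 1 a @ segment W a (p m)"
      using le less.prems by (intro segment_append)
    then have "length (segment W a (p m)) = length (clear us)"
      using m(2) by (simp add: rank_def)
    then have clear_us: "clear us = segment W a (p m)" and clear_r': "clear r' = segment W (p m) (dollar W)"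
      using less.prems(4) seg r by auto
    have "chain p (p m) (filter is_marker r') \<and> place W p (p m) (filter is_marker r') = r'"
    proof (rule less.hyps)
      fix r1 m' r2
      assume "r' = r1 @ m' # r2" "is_marker m'"
      then show "endpoint W (p m') \<and> rank W (p m') = rank W (p m) + length (clear r1)"
        using less.prems(1)[of "us @ m # r1" m' r2] r m(2) by simp
    qed (use r dom clear_r' in auto)
    then show ?thesis
      using r us le clear_us by auto
  qed
qed

section \<open>From ref-words to finitely many orders of markers\<close>

definition marker_orders :: "'v set \<Rightarrow> ('a, 'v) refsym list set" where
  "marker_orders V = {ms. distinct ms \<and> set ms = markers V \<and>
     (\<forall>x \<in> V. \<exists>ms1 ms2 ms3. ms = ms1 @ Opening x # ms2 @ Closing x # ms3)}"

lemma finite_marker_orders: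
  assumes "finite V"
  shows "finite (marker_orders V :: ('a, 'v) refsym list set)"
proof (rule finite_subset)
  let ?M = "markers V :: ('a, 'v) refsym set"
  have "finite ?M"
    using assms by (simp add: markers_def)
  then show "finite {ms. set ms \<subseteq> ?M \<and> length ms \<le> card ?M}"
    by (rule finite_lists_length_le)
  show "marker_orders V \<subseteq> {ms. set ms \<subseteq> ?M \<and> length ms \<le> card ?M}"
    by (auto simp: marker_orders_def simp flip: distinct_card)
qed

text \<open>This replaces the quantifier over ref-words by a finite disjunction. From left to right,
  \<open>ms\<close> is the marker sequence of \<open>r\<close>, and placing it gives back
  \<open>r\<close>. From right to left, the placed word is the required ref-word, and its spans are
  read off by splitting it at the two markers of each variable.\<close>

lemma functional_spans_iff:
  assumes "functional \<alpha>" and p: "\<And>m. m \<in> markers (rvars \<alpha>) \<Longrightarrow> endpoint W (p m)"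
  shows "(\<exists>r \<in> ref_words \<alpha>. clear r = word_of W \<and>
      (\<forall>x \<in> rvars \<alpha>. ref_span r x (rank W (p (Opening x)), rank W (p (Closing x))))) \<longleftrightarrow>
    (\<exists>ms \<in> marker_orders (rvars \<alpha>). chain p 1 ms \<and> place W p 1 ms \<in> ref_words \<alpha>)" (is "?L \<longleftrightarrow> ?R")
proof
  assume ?L
  then obtain r where r: "r \<in> ref_words \<alpha>" "clear r = word_of W"
    and spans: "\<And>x. x \<in> rvars \<alpha> \<Longrightarrow> ref_span r x (rank W (p (Opening x)), rank W (p (Closing x)))"
    by blast
  have once: "count_list r m = 1" if "m \<in> markers (rvars \<alpha>)" for m
    using functional_count[OF assms(1) r(1) that] .
  define ms where "ms = filter is_marker r"
  \<comment> \<open>A marker occurs only once in \<open>r\<close>, so any decomposition at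
    \<open>m\<close> is the one that \<open>ref_span\<close> provides, and \<open>spans\<close>
    determines the rank.\<close>
  have "endpoint W (p m) \<and> rank W (p m) = rank W 1 + length (clear r1)"
    if eq: "r = r1 @ m # r2" and "is_marker m" for r1 m r2
  proof -
    have m: "m \<in> markers (rvars \<alpha>)"
      using ref_words_markers[OF r(1)] that by simp
    then obtain x where x: "x \<in> rvars \<alpha>" "m = Opening x \<or> m = Closing x"
      by (auto simp: markers_def)
    obtain s1 s2 s3 where s: "r = s1 @ [Opening x] @ s2 @ [Closing x] @ s3"
      "rank W (p (Opening x)) = length (clear s1) + 1" "rank W (p (Closing x)) = length (clear (s1 @ s2)) + 1"
      using spans[OF x(1)] by (auto simp: ref_span_def)
    from x(2) have "rank W (p m) = length (clear r1) + 1"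
    proof
      assume "m = Opening x"
      then have "r1 = s1"
        using append_Cons_unique[of r1 m r2 s1 "s2 @ [Closing x] @ s3"] eq s(1) once[OF m] by (metis append_Cons append_Nil)
      then show ?thesis
        using s \<open>m = Opening x\<close> by simp
    next
      assume "m = Closing x"
      then have "r1 = s1 @ [Opening x] @ s2"
        using append_Cons_unique[of r1 m r2 "s1 @ [Opening x] @ s2" s3] eq s(1) once[OF m]
        by (metis append.assoc append_Cons append_Nil)
      then show ?thesis
        using s \<open>m = Closing x\<close> by simp
    qed
    then show ?thesis
      using p[OF m] by (simp add: rank_def)
  qed
  then have "chain p 1 ms \<and> place W p 1 ms = r"
    unfolding ms_def using r(2)
    by (intro place_filter_is_marker) (auto simp: dollar_def word_of_segment)
  moreover have "ms \<in> marker_orders (rvars \<alpha>)"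
    unfolding marker_orders_def mem_Collect_eq
  proof (intro conjI ballI)
    have "count_list ms m \<le> 1" for m
    proof (cases "m \<in> set ms")
      case True
      then have "is_marker m" "m \<in> set r"
        by (auto simp: ms_def)
      then show ?thesis
        using once[OF ref_words_markers[OF r(1)]] by (simp add: ms_def count_list_filter)
    qed (simp add: count_list_0_iff)
    then show "distinct ms"
      by (rule distinct_if_count_le_1)
    have "m \<in> set r" if "m \<in> markers (rvars \<alpha>)" for m
      using once[OF that] count_list_0_iff[of r m] by (metis zero_neq_one)
    then show "set ms = markers (rvars \<alpha>)"
      using ref_words_markers[OF r(1)] is_marker_markers by (auto simp: ms_def)
    fix x
    assume "x \<in> rvars \<alpha>"
    then obtain s1 s2 s3 where "r = s1 @ [Opening x] @ s2 @ [Closing x] @ s3"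
      using spans[of x] by (auto simp: ref_span_def)
    then show "\<exists>ms1 ms2 ms3. ms = ms1 @ Opening x # ms2 @ Closing x # ms3"
      by (auto simp: ms_def)
  qed
  ultimately show ?R
    using r(1) by blast
next
  assume ?R
  then obtain ms where ms: "ms \<in> marker_orders (rvars \<alpha>)" "chain p 1 ms" "place W p 1 ms \<in> ref_words \<alpha>"
    by blast
  have marker: "\<forall>m \<in> set ms. is_marker m \<and> p m \<le> dollar W"
    using ms(1) is_marker_markers endpoint_in_dom[OF p]
    by (fastforce simp: marker_orders_def dom_of_def dollar_def)
  have "clear (place W p 1 ms) = word_of W"
    using ms(2) marker by (simp add: clear_place word_of_segment dollar_def)
  moreover have "ref_span (place W p 1 ms) x (rank W (p (Opening x)), rank W (p (Closing x)))"
    if "x \<in> rvars \<alpha>" for x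
  proof -
    obtain ms1 ms2 ms3 where eq: "ms = ms1 @ Opening x # ms2 @ Closing x # ms3"
      using ms(1) \<open>x \<in> rvars \<alpha>\<close> unfolding marker_orders_def by blast
    obtain X where X: "place W p 1 ms = X @ Opening x # place W p (p (Opening x)) (ms2 @ Closing x # ms3)"
        "clear X = segment W 1 (p (Opening x))"
      using place_append[of p 1 ms1 "Opening x" "ms2 @ Closing x # ms3" W] ms(2) marker
      unfolding eq by auto
    have ch: "1 \<le> p (Opening x)" "chain p (p (Opening x)) (ms2 @ Closing x # ms3)"
      using chain_append[of p 1 ms1] ms(2) eq by blast+
    obtain Y where Y: "place W p (p (Opening x)) (ms2 @ Closing x # ms3) =
        Y @ Closing x # place W p (p (Closing x)) ms3" "clear Y = segment W (p (Opening x)) (p (Closing x))"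
      using place_append[OF ch(2)] marker unfolding eq by auto
    have "p (Opening x) \<le> p (Closing x)"
      using chain_append[OF ch(2)] by blast
    then have "segment W 1 (p (Closing x)) = clear (X @ Y)"
      using X Y ch segment_append[of 1 "p (Opening x)" "p (Closing x)" W] by simp
    then show ?thesis
      unfolding ref_span_def using X Y
      by (intro exI[of _ X] exI[of _ Y] exI[of _ "place W p (p (Closing x)) ms3"]) (simp add: rank_def)
  qed
  ultimately show ?L
    using ms(3) by blast
qed


section \<open>First-order definability of spanners\<close>

definition conjunction :: "'a fm list \<Rightarrow> 'a fm" where
  "conjunction \<phi>s = Neg (disj (map Neg \<phi>s))"

lemma conjunction_simps [simp]:
  "sat W A e (conjunction \<phi>s) \<longleftrightarrow> (\<forall>\<phi> \<in> set \<phi>s. sat W A e \<phi>)"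
  "wf_fm ars (conjunction \<phi>s) \<longleftrightarrow> (\<forall>\<phi> \<in> set \<phi>s. wf_fm ars \<phi>)"
  "fv (conjunction \<phi>s) = (\<Union>\<phi> \<in> set \<phi>s. fv \<phi>)"
  by (auto simp: conjunction_def)

fun exs :: "nat list \<Rightarrow> 'a fm \<Rightarrow> 'a fm" where
  "exs [] \<phi> = \<phi>"
| "exs (v # vs) \<phi> = Ex v (exs vs \<phi>)"

lemma wf_fm_exs [simp]: "wf_fm ars (exs vs \<phi>) \<longleftrightarrow> wf_fm ars \<phi>"
  by (induction vs) auto

lemma fv_exs [simp]: "fv (exs vs \<phi>) = fv \<phi> - set vs"
  by (induction vs) auto

lemma sat_exs:
  "sat W A e (exs vs \<phi>) \<longleftrightarrow>
     (\<exists>e'. (\<forall>v. v \<notin> set vs \<longrightarrow> e' v = e v) \<and> (\<forall>v \<in> set vs. e' v \<in> dom_of W) \<and> sat W A e' \<phi>)"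
proof (induction vs arbitrary: e)
  case Nil
  then show ?case
    by (auto simp flip: fun_eq_iff)
next
  case (Cons v vs)
  show ?case (is "?L \<longleftrightarrow> ?R")
  proof
    assume ?L
    then obtain d e' where "d \<in> dom_of W" "\<And>u. u \<notin> set vs \<Longrightarrow> e' u = (e(v := d)) u"
        "\<And>u. u \<in> set vs \<Longrightarrow> e' u \<in> dom_of W" "sat W A e' \<phi>"
      by (auto simp: Cons.IH)
    then show ?R
      by (intro exI[of _ e']) (auto split: if_splits, metis)
  next
    assume ?R
    then obtain e' where "\<And>u. u \<notin> set (v # vs) \<Longrightarrow> e' u = e u"
        "\<And>u. u \<in> set (v # vs) \<Longrightarrow> e' u \<in> dom_of W" "sat W A e' \<phi>"
      by blast
    then show ?L
      by (auto simp: Cons.IH intro!: bexI[of _ "e' v"] exI[of _ e'])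
  qed
qed

definition Endpoint :: "tm \<Rightarrow> 'a::finite fm" where
  "Endpoint t = Or (Eq t Dollar) (Neg (Blank t))"

lemma Endpoint_simps [simp]:
  "wf_fm ars (Endpoint t)"
  "fv (Endpoint t) = fv_tm t"
  "eval_tm W e t \<in> dom_of W \<Longrightarrow> sat W A e (Endpoint t) \<longleftrightarrow> endpoint W (eval_tm W e t)"
  by (auto simp: Endpoint_def endpoint_def symbol_element_def dom_of_def dollar_def)

text \<open>An accepting run of the quotient automaton on the placed ref-word: stretches of letters
  are crossed by run relations, markers are read by quotients, and a state accepts iff it contains
  the empty word. The test \<open>Le\<close> supplies the order that run relations do not
  check.\<close>

fun Path :: "('a, 'v) refsym list set list \<Rightarrow> (('a, 'v) refsym \<Rightarrow> nat) \<Rightarrow> tm \<Rightarrow>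
    ('a, 'v) refsym list \<Rightarrow> ('a, 'v) refsym list set \<Rightarrow> 'a fm" where
  "Path qs f t [] K = disj (map (\<lambda>K'. Aux (run_symbol qs K K') [t, Dollar]) (filter (\<lambda>K'. [] \<in> K') qs))"
| "Path qs f t (m # ms) K = And (Le t (Var (f m)))
     (disj (map (\<lambda>K'. And (Aux (run_symbol qs K K') [t, Var (f m)])
        (Path qs f (Var (f m)) ms (left_quotient [m] K'))) qs))"

lemma fv_Path: "fv (Path qs f t ms K) \<subseteq> fv_tm t \<union> f ` set ms"
  by (induction ms arbitrary: t K) (auto, fastforce)

context quotient_states
begin

lemma wf_fm_Path: "K \<in> set qs \<Longrightarrow> wf_fm (base_arities qs) (Path qs f t ms K)"
proof (induction ms arbitrary: t K)
  case Nil
  then show ?case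
    using run_symbol(2,3)[of K qs] by (auto simp: numeral_2_eq_2)
next
  case (Cons m ms)
  then show ?case
    using run_symbol(2,3)[of K qs] quotient_closed by (auto simp: numeral_2_eq_2)
qed

lemma sat_Path:
  assumes "K \<in> set qs" "eval_tm W e t \<in> dom_of W" "\<And>m. m \<in> set ms \<Longrightarrow> e (f m) \<in> dom_of W"
  shows "sat W (base_relations qs W) e (Path qs f t ms K) \<longleftrightarrow>
    chain (\<lambda>m. e (f m)) (eval_tm W e t) ms \<and> place W (\<lambda>m. e (f m)) (eval_tm W e t) ms \<in> K"
  using assms
proof (induction ms arbitrary: t K)
  case Nil
  have "dollar W \<in> dom_of W"
    by (simp add: dom_of_def dollar_def)
  then show ?case
    using Nil quotient_in_states[of K "map Letter (segment W (eval_tm W e t) (dollar W))"]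
    by (auto simp: base_relations_run_symbol in_run_relation Nil_in_quotient)
next
  case (Cons m ms)
  \<comment> \<open>By determinism, this is the only state for which a disjunct of
    \<open>Path\<close> can hold.\<close>
  let ?K = "left_quotient (map Letter (segment W (eval_tm W e t) (e (f m)))) K"
  have "?K \<in> set qs"
    using Cons.prems quotient_in_states by blast
  have "sat W (base_relations qs W) e (Path qs f t (m # ms) K) \<longleftrightarrow> eval_tm W e t \<le> e (f m) \<and>
      sat W (base_relations qs W) e (Path qs f (Var (f m)) ms (left_quotient [m] ?K))"
    using Cons.prems \<open>?K \<in> set qs\<close> by (auto simp: base_relations_run_symbol in_run_relation not_less)
  also have "\<dots> \<longleftrightarrow> eval_tm W e t \<le> e (f m) \<and> chain (\<lambda>m. e (f m)) (e (f m)) ms \<and>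
      place W (\<lambda>m. e (f m)) (e (f m)) ms \<in> left_quotient [m] ?K"
    using Cons.prems \<open>?K \<in> set qs\<close> quotient_closed by (subst Cons.IH) auto
  finally show ?case
    by (simp add: left_quotient_def)
qed

end

section \<open>Spanners expressed by formulas\<close>

definition span_vars :: "('v \<Rightarrow> nat) \<Rightarrow> 'v set \<Rightarrow> nat set" where
  "span_vars idx V = (\<Union>x \<in> V. {2 * idx x, 2 * idx x + 1})"

text \<open>Even variables hold left ends and odd ones right ends, matching the components
  \<open>2 * i\<close> and \<open>2 * i + 1\<close> in \<open>spanner_relation\<close>.\<close>

definition assignment :: "('v \<Rightarrow> nat) \<Rightarrow> 'v set \<Rightarrow> 'a word_structure \<Rightarrow> (nat \<Rightarrow> nat) \<Rightarrow> 'v \<rightharpoonup> span" where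
  "assignment idx V W e =
     (\<lambda>x. if x \<in> V then Some (rank W (e (2 * idx x)), rank W (e (2 * idx x + 1))) else None)"

lemma dom_assignment [simp]: "dom (assignment idx V W e) = V"
  by (auto simp: assignment_def dom_def)

lemma assignment_restrict: "Y \<subseteq> V \<Longrightarrow> assignment idx V W e |` Y = assignment idx Y W e"
  by (intro ext) (auto simp: assignment_def restrict_map_def)

text \<open>The endpoint condition is part of the meaning because different positions can have the
  same rank. It also makes difference a plain conjunction with a negation: the positive conjunct
  ensures the endpoints, so the negation can only fail membership.\<close>

definition expresses ::
    "('a, 'v) refsym list set list \<Rightarrow> ('v \<Rightarrow> nat) \<Rightarrow> ('a, 'v) spanner \<Rightarrow> 'a fm \<Rightarrow> bool" where
  "expresses qs idx P \<psi> \<longleftrightarrow>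
     wf_fm (base_arities qs) \<psi> \<and> fv \<psi> \<subseteq> span_vars idx (svars P) \<and>
     (\<forall>W e. (\<forall>v \<in> span_vars idx (svars P). e v \<in> dom_of W) \<longrightarrow>
        (sat W (base_relations qs W) e \<psi> \<longleftrightarrow>
           (\<forall>v \<in> span_vars idx (svars P). endpoint W (e v)) \<and>
           assignment idx (svars P) W e \<in> spanner_eval P (word_of W)))"

text \<open>Allowing every injective numbering lets a join use one numbering for both operands,
  which identifies shared variables, and lets a projection renumber the hidden variables away from
  the visible ones.\<close>

definition expressible :: "('a, 'v) refsym list set list \<Rightarrow> ('a, 'v) spanner \<Rightarrow> bool" where
  "expressible qs P \<longleftrightarrow> (\<forall>idx. inj_on idx (svars P) \<longrightarrow> (\<exists>\<psi>. expresses qs idx P \<psi>))"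

definition span_map :: "'a list \<Rightarrow> 'v set \<Rightarrow> ('v \<rightharpoonup> span) \<Rightarrow> bool" where
  "span_map w V \<mu> \<longleftrightarrow>
     dom \<mu> = V \<and> (\<forall>x i j. \<mu> x = Some (i, j) \<longrightarrow> 1 \<le> i \<and> i \<le> j \<and> j \<le> length w + 1)"

text \<open>Ordered span ends are needed for string equality, since \<open>seg_eq\<close> rejects
  reversed intervals; bounded ones are needed for projection, where hidden ends must be represented
  by positions.\<close>

definition proper_spanner :: "('a, 'v) spanner \<Rightarrow> bool" where
  "proper_spanner P \<longleftrightarrow> finite (svars P) \<and> (\<forall>w. \<forall>\<mu> \<in> spanner_eval P w. span_map w (svars P) \<mu>)"

lemma proper_spanner_eval:
  assumes "proper_spanner P" "\<mu> \<in> spanner_eval P w"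
  shows "dom \<mu> = svars P" "\<mu> x = Some (i, j) \<Longrightarrow> 1 \<le> i \<and> i \<le> j \<and> j \<le> length w + 1"
proof -
  have *: "span_map w (svars P) \<mu>"
    using assms by (simp add: proper_spanner_def)
  then show "dom \<mu> = svars P"
    by (simp add: span_map_def)
  show "1 \<le> i \<and> i \<le> j \<and> j \<le> length w + 1" if "\<mu> x = Some (i, j)"
    using * that unfolding span_map_def by blast
qed

lemma span_map_restrict:
  assumes "span_map w V \<mu>" "Y \<subseteq> V"
  shows "span_map w Y (\<mu> |` Y)"
proof -
  have "\<mu> x = Some (i, j)" if "(\<mu> |` Y) x = Some (i, j)" for x i j
    using that by (simp add: restrict_map_def split: if_splits)
  then show ?thesis
    using assms unfolding span_map_def by (metis dom_restrict inf.absorb_iff2)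
qed

lemma span_map_join:
  assumes "dom \<mu> = A \<union> B" "span_map w A (\<mu> |` A)" "span_map w B (\<mu> |` B)"
  shows "span_map w (A \<union> B) \<mu>"
  unfolding span_map_def
proof (intro conjI allI impI)
  fix x i j
  assume x: "\<mu> x = Some (i, j)"
  then have "(\<mu> |` A) x = Some (i, j) \<or> (\<mu> |` B) x = Some (i, j)"
    using assms(1) by (auto simp: restrict_map_def)
  then have "1 \<le> i \<and> i \<le> j \<and> j \<le> length w + 1"
    using assms(2,3) unfolding span_map_def by blast
  then show "1 \<le> i" "i \<le> j" "j \<le> length w + 1"
    by auto
qed (fact assms(1))

lemma proper_regex_spanner: "proper_spanner (regex_spanner \<alpha>)"
  unfolding proper_spanner_def
proof (intro conjI allI ballI)
  show "finite (svars (regex_spanner \<alpha>))"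
    by (simp add: regex_spanner_def)
next
  fix w \<mu>
  assume "\<mu> \<in> spanner_eval (regex_spanner \<alpha>) w"
  then obtain r where \<mu>: "dom \<mu> = rvars \<alpha>" "clear r = w" "\<forall>x \<in> rvars \<alpha>. ref_span r x (the (\<mu> x))"
    unfolding regex_spanner_def by auto
  have "1 \<le> i \<and> i \<le> j \<and> j \<le> length w + 1" if "\<mu> x = Some (i, j)" for x i j
  proof -
    have "x \<in> rvars \<alpha>"
      using \<mu>(1) that by (simp add: domI flip: \<mu>(1))
    then have "ref_span r x (i, j)"
      using bspec[OF \<mu>(3)] that by (metis option.sel)
    then show ?thesis
      unfolding ref_span_def using \<mu>(2) by auto
  qed
  then show "span_map w (svars (regex_spanner \<alpha>)) \<mu>"
    using \<mu>(1) by (simp add: span_map_def regex_spanner_def)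
qed

lemma generalized_core_spanner_proper: "generalized_core_spanner P \<Longrightarrow> proper_spanner P"
proof (induction rule: generalized_core_spanner.induct)
  case (regex \<alpha>)
  show ?case
    by (rule proper_regex_spanner)
next
  case (union P Q)
  then show ?case
    by (auto simp: proper_spanner_def union_spanner_def)
next
  case (diff P Q)
  then show ?case
    by (auto simp: proper_spanner_def diff_spanner_def)
next
  case (proj P Y)
  then show ?case
    unfolding proper_spanner_def proj_spanner_def
    by (auto intro: span_map_restrict[OF _ proj.hyps(2)] finite_subset)
next
  case (join P Q)
  then show ?case
    unfolding proper_spanner_def join_spanner_def by (auto intro: span_map_join)
next
  case (eq_select P x y)
  then show ?case
    by (auto simp: proper_spanner_def eq_select_spanner_def)
qed

section \<open>Closure under the spanner operations\<close>

lemma expressible_union: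
  fixes P Q :: "('a, 'v) spanner"
  assumes "expressible qs P" "expressible qs Q" "svars P = svars Q"
  shows "expressible qs (union_spanner P Q)"
  unfolding expressible_def
proof (intro allI impI)
  fix idx :: "'v \<Rightarrow> nat"
  assume "inj_on idx (svars (union_spanner P Q))"
  then obtain \<phi> \<psi> where "expresses qs idx P \<phi>" "expresses qs idx Q \<psi>"
    using assms unfolding expressible_def union_spanner_def by (metis spanner.select_convs(1))
  then have "expresses qs idx (union_spanner P Q) (Or \<phi> \<psi>)"
    using assms(3) by (auto simp: expresses_def union_spanner_def)
  then show "\<exists>\<psi>. expresses qs idx (union_spanner P Q) \<psi>" ..
qed

lemma expressible_diff:
  fixes P Q :: "('a, 'v) spanner"
  assumes "expressible qs P" "expressible qs Q" "svars P = svars Q"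
  shows "expressible qs (diff_spanner P Q)"
  unfolding expressible_def
proof (intro allI impI)
  fix idx :: "'v \<Rightarrow> nat"
  assume "inj_on idx (svars (diff_spanner P Q))"
  then obtain \<phi> \<psi> where "expresses qs idx P \<phi>" "expresses qs idx Q \<psi>"
    using assms unfolding expressible_def diff_spanner_def by (metis spanner.select_convs(1))
  then have "expresses qs idx (diff_spanner P Q) (And \<phi> (Neg \<psi>))"
    using assms(3) by (auto simp: expresses_def diff_spanner_def)
  then show "\<exists>\<psi>. expresses qs idx (diff_spanner P Q) \<psi>" ..
qed

lemma span_vars_Un: "span_vars idx (A \<union> B) = span_vars idx A \<union> span_vars idx B"
  by (auto simp: span_vars_def)

lemma expressible_join:
  fixes P Q :: "('a, 'v) spanner"
  assumes "expressible qs P" "expressible qs Q"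
  shows "expressible qs (join_spanner P Q)"
  unfolding expressible_def
proof (intro allI impI)
  fix idx :: "'v \<Rightarrow> nat"
  assume "inj_on idx (svars (join_spanner P Q))"
  then have "inj_on idx (svars P)" "inj_on idx (svars Q)"
    by (simp_all add: join_spanner_def inj_on_Un)
  then obtain \<phi> \<psi> where "expresses qs idx P \<phi>" "expresses qs idx Q \<psi>"
    using assms unfolding expressible_def by blast
  then have "expresses qs idx (join_spanner P Q) (And \<phi> \<psi>)"
    by (auto simp: expresses_def join_spanner_def span_vars_Un assignment_restrict)
  then show "\<exists>\<psi>. expresses qs idx (join_spanner P Q) \<psi>" ..
qed

lemma expressible_eq_select:
  fixes P :: "('a, 'v) spanner"
  assumes "expressible qs P" "proper_spanner P" "x \<in> svars P" "y \<in> svars P"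
  shows "expressible qs (eq_select_spanner x y P)"
  unfolding expressible_def
proof (intro allI impI)
  fix idx :: "'v \<Rightarrow> nat"
  assume "inj_on idx (svars (eq_select_spanner x y P))"
  then obtain \<phi> where \<phi>: "expresses qs idx P \<phi>"
    using assms by (auto simp: expressible_def eq_select_spanner_def)
  let ?E = "Aux 0 [Var (2 * idx x), Var (2 * idx x + 1), Var (2 * idx y), Var (2 * idx y + 1)]"
  have "expresses qs idx (eq_select_spanner x y P) (And \<phi> ?E)"
    unfolding expresses_def
  proof (intro conjI allI impI)
    show "wf_fm (base_arities qs) (And \<phi> ?E)"
      using \<phi> by (simp add: expresses_def base_arities_def)
    show "fv (And \<phi> ?E) \<subseteq> span_vars idx (svars (eq_select_spanner x y P))"
      using \<phi> assms(3,4) by (auto simp: expresses_def eq_select_spanner_def span_vars_def)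
    fix W :: "'a word_structure" and e
    assume dom: "\<forall>v \<in> span_vars idx (svars (eq_select_spanner x y P)). e v \<in> dom_of W"
    let ?\<mu> = "assignment idx (svars P) W e"
    have sat_\<phi>: "sat W (base_relations qs W) e \<phi> \<longleftrightarrow>
        (\<forall>v \<in> span_vars idx (svars P). endpoint W (e v)) \<and> ?\<mu> \<in> spanner_eval P (word_of W)"
      using \<phi> dom by (simp add: expresses_def eq_select_spanner_def)
    \<comment> \<open>Where \<open>\<phi>\<close> holds, the ranks form a proper span and the
      positions are endpoints, so the positions are ordered like their ranks.\<close>
    have seg: "e (2 * idx z) \<le> e (2 * idx z + 1) \<and>
        factor (word_of W) (the (?\<mu> z)) = segment W (e (2 * idx z)) (e (2 * idx z + 1))"
      if "sat W (base_relations qs W) e \<phi>" "z \<in> svars P" for z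
    proof -
      have ends: "endpoint W (e (2 * idx z))" "endpoint W (e (2 * idx z + 1))"
        using that sat_\<phi> by (auto simp: span_vars_def)
      have \<mu>z: "?\<mu> z = Some (rank W (e (2 * idx z)), rank W (e (2 * idx z + 1)))"
        using that by (simp add: assignment_def)
      then have "rank W (e (2 * idx z)) \<le> rank W (e (2 * idx z + 1))"
        using proper_spanner_eval(2)[OF assms(2)] sat_\<phi> that by blast
      then have le: "e (2 * idx z) \<le> e (2 * idx z + 1)"
        using le_if_rank_le[OF ends(2)] endpoint_in_dom[OF ends(1)] by (simp add: dom_of_def dollar_def)
      then show ?thesis
        using factor_rank[OF endpoint_in_dom endpoint_in_dom, OF ends] \<mu>z by simp
    qed
    have in_dom: "{e (2 * idx x), e (2 * idx x + 1), e (2 * idx y), e (2 * idx y + 1)} \<subseteq> dom_of W"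
      using dom assms(3,4) by (auto simp: span_vars_def eq_select_spanner_def)
    have "sat W (base_relations qs W) e ?E \<longleftrightarrow>
        seg_eq W (e (2 * idx x)) (e (2 * idx x + 1)) (e (2 * idx y)) (e (2 * idx y + 1))"
      using in_dom by (simp add: base_relations_def in_eq_relation)
    then show "sat W (base_relations qs W) e (And \<phi> ?E) \<longleftrightarrow>
        (\<forall>v \<in> span_vars idx (svars (eq_select_spanner x y P)). endpoint W (e v)) \<and>
        assignment idx (svars (eq_select_spanner x y P)) W e \<in> spanner_eval (eq_select_spanner x y P) (word_of W)"
      using sat_\<phi> seg[OF _ assms(3)] seg[OF _ assms(4)]
      by (auto simp: eq_select_spanner_def seg_eq_def)
  qed
  then show "\<exists>\<psi>. expresses qs idx (eq_select_spanner x y P) \<psi>" ..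
qed

lemma inj_on_extend:
  fixes f :: "'v \<Rightarrow> nat"
  assumes "finite A" "Y \<subseteq> A" "inj_on f Y"
  shows "\<exists>g. inj_on g A \<and> (\<forall>y \<in> Y. g y = f y)"
proof -
  obtain h :: "'v \<Rightarrow> nat" where h: "inj_on h A"
    using finite_imp_inj_to_nat_seg[OF assms(1)] by blast
  obtain M where M: "\<forall>y \<in> Y. f y < M"
    using finite_nat_set_iff_bounded[of "f ` Y"] finite_subset[OF assms(2,1)] by auto
  define g where "g = (\<lambda>x. if x \<in> Y then f x else M + h x)"
  have "inj_on g A"
    using h assms(3) M unfolding inj_on_def g_def
    by (metis add_left_cancel not_add_less1)
  then show ?thesis
    by (auto simp: g_def)
qed

lemma expressible_proj:
  fixes P :: "('a, 'v) spanner"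
  assumes "expressible qs P" "proper_spanner P" "Y \<subseteq> svars P"
  shows "expressible qs (proj_spanner Y P)"
  unfolding expressible_def
proof (intro allI impI)
  fix idx :: "'v \<Rightarrow> nat"
  assume "inj_on idx (svars (proj_spanner Y P))"
  then have "inj_on idx Y"
    by (simp add: proj_spanner_def)
  then obtain idx' where inj: "inj_on idx' (svars P)" and idx': "\<And>y. y \<in> Y \<Longrightarrow> idx' y = idx y"
    using inj_on_extend[of "svars P" Y idx] assms by (auto simp: proper_spanner_def)
  obtain \<phi> where \<phi>: "expresses qs idx' P \<phi>"
    using assms inj by (auto simp: expressible_def)
  have "finite (span_vars idx' (svars P - Y))"
    using assms(2) by (auto simp: span_vars_def proper_spanner_def)
  then obtain vs where vs: "set vs = span_vars idx' (svars P - Y)"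
    using finite_list by blast
  have "span_vars idx Y = span_vars idx' Y"
    using idx' by (simp add: span_vars_def)
  then have split_vars: "span_vars idx' (svars P) = span_vars idx Y \<union> set vs"
    using assms(3) vs span_vars_Un[of idx' Y "svars P - Y"] by (simp add: Un_absorb1)
  have disjoint: "span_vars idx Y \<inter> set vs = {}"
  proof -
    have "idx' x \<noteq> idx' y" if "x \<in> svars P - Y" "y \<in> Y" for x y
      using that inj assms(3) by (metis DiffD1 DiffD2 inj_onD subsetD)
    then show ?thesis
      using idx' by (fastforce simp: vs span_vars_def)
  qed
  have "expresses qs idx (proj_spanner Y P) (exs vs \<phi>)"
    unfolding expresses_def
  proof (intro conjI allI impI)
    show "wf_fm (base_arities qs) (exs vs \<phi>)"
      using \<phi> by (simp add: expresses_def)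
    show "fv (exs vs \<phi>) \<subseteq> span_vars idx (svars (proj_spanner Y P))"
      using \<phi> split_vars by (auto simp: expresses_def proj_spanner_def)
    fix W :: "'a word_structure" and e
    assume "\<forall>v \<in> span_vars idx (svars (proj_spanner Y P)). e v \<in> dom_of W"
    then have dom: "\<And>v. v \<in> span_vars idx Y \<Longrightarrow> e v \<in> dom_of W"
      by (simp add: proj_spanner_def)
    have sat_\<phi>: "sat W (base_relations qs W) e' \<phi> \<longleftrightarrow>
        (\<forall>v \<in> span_vars idx' (svars P). endpoint W (e' v)) \<and>
        assignment idx' (svars P) W e' \<in> spanner_eval P (word_of W)"
      if "\<And>v. v \<notin> set vs \<Longrightarrow> e' v = e v" "\<And>v. v \<in> set vs \<Longrightarrow> e' v \<in> dom_of W" for e'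
    proof -
      have "\<forall>v \<in> span_vars idx' (svars P). e' v \<in> dom_of W"
        using that dom split_vars by (metis UnE)
      then show ?thesis
        using \<phi> by (simp add: expresses_def)
    qed
    have restrict: "assignment idx' (svars P) W e' |` Y = assignment idx Y W e"
      if "\<And>v. v \<notin> set vs \<Longrightarrow> e' v = e v" for e'
    proof -
      have "e' (2 * idx y) = e (2 * idx y)" "e' (2 * idx y + 1) = e (2 * idx y + 1)" if "y \<in> Y" for y
        using that disjoint \<open>\<And>v. v \<notin> set vs \<Longrightarrow> e' v = e v\<close> by (auto simp: span_vars_def)
      then have "assignment idx' Y W e' = assignment idx Y W e"
        using idx' by (auto simp: assignment_def)
      then show ?thesis
        using assms(3) by (simp add: assignment_restrict)
    qed
    have "sat W (base_relations qs W) e (exs vs \<phi>) \<longleftrightarrow>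
        (\<forall>v \<in> span_vars idx Y. endpoint W (e v)) \<and>
        assignment idx Y W e \<in> (\<lambda>\<mu>. \<mu> |` Y) ` spanner_eval P (word_of W)" (is "?L \<longleftrightarrow> ?R")
    proof
      assume ?L
      then obtain e' where e': "\<And>v. v \<notin> set vs \<Longrightarrow> e' v = e v" "\<And>v. v \<in> set vs \<Longrightarrow> e' v \<in> dom_of W"
          "sat W (base_relations qs W) e' \<phi>"
        by (auto simp: sat_exs)
      have "endpoint W (e v)" if "v \<in> span_vars idx Y" for v
        using that e' sat_\<phi>[of e'] split_vars disjoint by (metis IntI UnI1 empty_iff)
      then show ?R
        using restrict[of e'] sat_\<phi>[of e'] e' by (metis image_eqI)
    next
      assume ?R
      then obtain \<mu> where \<mu>: "\<mu> \<in> spanner_eval P (word_of W)" "assignment idx Y W e = \<mu> |` Y"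
        and ends: "\<And>v. v \<in> span_vars idx Y \<Longrightarrow> endpoint W (e v)"
        by blast
      note dom_\<mu> = proper_spanner_eval(1)[OF assms(2) \<mu>(1)]
      \<comment> \<open>Proper spans lie in the range of \<open>rank\<close>; this yields positions
        as witnesses for the quantified ends.\<close>
      have "\<exists>c d. endpoint W c \<and> endpoint W d \<and> \<mu> x = Some (rank W c, rank W d)" if x: "x \<in> svars P" for x
      proof -
        obtain i j where ij: "\<mu> x = Some (i, j)"
          using x dom_\<mu> by (metis domD surj_pair)
        then have "1 \<le> i" "i \<le> j" "j \<le> length (word_of W) + 1"
          using proper_spanner_eval(2)[OF assms(2) \<mu>(1)] by blast+
        then show ?thesis
          using rank_surj[of i W] rank_surj[of j W] ij by auto
      qed
      then obtain c d where cd: "\<And>x. x \<in> svars P \<Longrightarrow> endpoint W (c x) \<and> endpoint W (d x) \<and>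
          \<mu> x = Some (rank W (c x), rank W (d x))"
        by metis
      define inv where "inv = the_inv_into (svars P) idx'"
      \<comment> \<open>\<open>v div 2\<close> is the number of the hidden variable that owns
        \<open>v\<close>, and the parity of \<open>v\<close> selects the end of its span.\<close>
      define e' where "e' = (\<lambda>v. if v \<in> set vs then if even v then c (inv (v div 2)) else d (inv (v div 2)) else e v)"
      have inv: "inv (idx' x) = x" if "x \<in> svars P" for x
        using that inj by (simp add: inv_def the_inv_into_f_f)
      have e'_new: "e' (2 * idx' x) = c x" "e' (2 * idx' x + 1) = d x" if "x \<in> svars P - Y" for x
        using that inv by (auto simp: e'_def vs span_vars_def)
      have e'_vs: "endpoint W (e' v)" if "v \<in> set vs" for v
        using that e'_new cd by (auto simp: vs span_vars_def)
      have e'_old: "e' v = e v" if "v \<notin> set vs" for v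
        using that by (simp add: e'_def)
      have "\<forall>v \<in> span_vars idx' (svars P). endpoint W (e' v)"
        using split_vars e'_vs e'_old ends by (metis UnE)
      moreover have "assignment idx' (svars P) W e' = \<mu>"
      proof
        fix x
        consider "x \<in> Y" | "x \<in> svars P - Y" | "x \<notin> svars P"
          by blast
        then show "assignment idx' (svars P) W e' x = \<mu> x"
        proof cases
          case 1
          then show ?thesis
            using restrict[of e', OF e'_old] \<mu>(2) by (metis restrict_in)
        next
          case 2
          then show ?thesis
            using e'_new[OF 2] cd[of x] by (simp add: assignment_def)
        next
          case 3
          then show ?thesis
            using dom_\<mu> by (metis dom_assignment domIff)
        qed
      qed
      ultimately have "sat W (base_relations qs W) e' \<phi>"
        using sat_\<phi>[of e'] e'_old endpoint_in_dom[OF e'_vs] \<mu>(1) by simp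
      then show ?L
        unfolding sat_exs using e'_old endpoint_in_dom[OF e'_vs] by blast
    qed
    then show "sat W (base_relations qs W) e (exs vs \<phi>) \<longleftrightarrow>
        (\<forall>v \<in> span_vars idx (svars (proj_spanner Y P)). endpoint W (e v)) \<and>
        assignment idx (svars (proj_spanner Y P)) W e \<in> spanner_eval (proj_spanner Y P) (word_of W)"
      by (simp add: proj_spanner_def)
  qed
  then show "\<exists>\<psi>. expresses qs idx (proj_spanner Y P) \<psi>" ..
qed

section \<open>Regex formulas as disjunctions over marker orders\<close>

fun marker_var :: "('v \<Rightarrow> nat) \<Rightarrow> ('a, 'v) refsym \<Rightarrow> nat" where
  "marker_var idx (Letter a) = 0"
| "marker_var idx (Opening x) = 2 * idx x"
| "marker_var idx (Closing x) = 2 * idx x + 1"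

lemma marker_var_image: "marker_var idx ` markers V = span_vars idx V"
  by (auto simp: markers_def span_vars_def image_Un image_image)

lemma (in quotient_states) expressible_regex:
  assumes "functional \<alpha>" "ref_words \<alpha> \<in> set qs"
  shows "expressible qs (regex_spanner \<alpha>)"
  unfolding expressible_def
proof (intro allI impI)
  fix idx :: "'v \<Rightarrow> nat"
  let ?V = "span_vars idx (rvars \<alpha>)"
  have "finite ?V"
    by (simp add: span_vars_def)
  then obtain vs z where vs: "set vs = ?V" and z: "\<And>v. v \<in> ?V \<Longrightarrow> v < z"
    using finite_list finite_nat_set_iff_bounded by metis
  obtain mss where mss: "set mss = (marker_orders (rvars \<alpha>) :: ('a, 'v) refsym list set)"
    using finite_list[OF finite_marker_orders[OF finite_rvars]] by blast
  let ?f = "marker_var idx :: ('a, 'v) refsym \<Rightarrow> nat"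
  \<comment> \<open>The signature has no constant for the first position, so \<open>z\<close> is
    bound to the least element, where every run starts.\<close>
  define \<psi> where "\<psi> = And (conjunction (map (\<lambda>v. Endpoint (Var v)) vs))
    (Ex z (And (All (Suc z) (Le (Var z) (Var (Suc z))))
      (disj (map (\<lambda>ms. Path qs ?f (Var z) ms (ref_words \<alpha>)) mss))))"
  have markers_ms: "?f ` set ms = ?V" if "ms \<in> set mss" for ms
    using that marker_var_image[of idx "rvars \<alpha>"] by (simp add: mss marker_orders_def)
  have "expresses qs idx (regex_spanner \<alpha>) \<psi>"
    unfolding expresses_def
  proof (intro conjI allI impI)
    show "wf_fm (base_arities qs) \<psi>"
      using assms(2) by (auto simp: \<psi>_def wf_fm_Path)
    show "fv \<psi> \<subseteq> span_vars idx (svars (regex_spanner \<alpha>))"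
      using fv_Path[of qs ?f "Var z" _ "ref_words \<alpha>"] markers_ms vs
      by (fastforce simp: \<psi>_def regex_spanner_def)
    fix W :: "'a word_structure" and e
    assume "\<forall>v \<in> span_vars idx (svars (regex_spanner \<alpha>)). e v \<in> dom_of W"
    then have dom: "\<And>v. v \<in> ?V \<Longrightarrow> e v \<in> dom_of W"
      by (simp add: regex_spanner_def)
    have one: "1 \<in> dom_of W"
      by (simp add: dom_of_def)
    have least: "(\<forall>d' \<in> dom_of W. \<not> d' < d) \<longleftrightarrow> d = 1" if "d \<in> dom_of W" for d
      using that one by (fastforce simp: dom_of_def)
    have path: "sat W (base_relations qs W) (e(z := 1)) (Path qs ?f (Var z) ms (ref_words \<alpha>)) \<longleftrightarrow>
        chain (\<lambda>m. e (?f m)) 1 ms \<and> place W (\<lambda>m. e (?f m)) 1 ms \<in> ref_words \<alpha>"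
      if "ms \<in> set mss" for ms
    proof -
      have f: "?f m \<in> ?V" if "m \<in> set ms" for m
        using markers_ms[OF \<open>ms \<in> set mss\<close>] that by blast
      have *: "(e(z := 1)) (?f m) = e (?f m)" if "m \<in> set ms" for m
        using z[OF f[OF that]] by simp
      have "chain (\<lambda>m. (e(z := 1)) (?f m)) a ms' \<longleftrightarrow> chain (\<lambda>m. e (?f m)) a ms'"
        "place W (\<lambda>m. (e(z := 1)) (?f m)) a ms' = place W (\<lambda>m. e (?f m)) a ms'"
        if "set ms' \<subseteq> set ms" for a ms'
        using that * by (induction ms' arbitrary: a) auto
      moreover have "sat W (base_relations qs W) (e(z := 1)) (Path qs ?f (Var z) ms (ref_words \<alpha>)) \<longleftrightarrow>
          chain (\<lambda>m. (e(z := 1)) (?f m)) 1 ms \<and> place W (\<lambda>m. (e(z := 1)) (?f m)) 1 ms \<in> ref_words \<alpha>"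
        using * dom f one by (subst sat_Path[OF assms(2)]) auto
      ultimately show ?thesis
        by simp
    qed
    have "sat W (base_relations qs W) e \<psi> \<longleftrightarrow> (\<forall>v \<in> ?V. endpoint W (e v)) \<and>
        (\<exists>ms \<in> set mss. sat W (base_relations qs W) (e(z := 1)) (Path qs ?f (Var z) ms (ref_words \<alpha>)))"
      using dom one least by (auto simp: \<psi>_def vs)
    also have "\<dots> \<longleftrightarrow> (\<forall>v \<in> ?V. endpoint W (e v)) \<and> (\<exists>ms \<in> marker_orders (rvars \<alpha>).
        chain (\<lambda>m. e (?f m)) 1 ms \<and> place W (\<lambda>m. e (?f m)) 1 ms \<in> ref_words \<alpha>)"
      using path mss by auto
    also have "\<dots> \<longleftrightarrow> (\<forall>v \<in> ?V. endpoint W (e v)) \<and> (\<exists>r \<in> ref_words \<alpha>. clear r = word_of W \<and>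
      (\<forall>x \<in> rvars \<alpha>. ref_span r x (rank W (e (2 * idx x)), rank W (e (2 * idx x + 1)))))"
      using functional_spans_iff[OF assms(1), of W "\<lambda>m. e (?f m)"] marker_var_image[of idx "rvars \<alpha>"]
      by auto
    also have "\<dots> \<longleftrightarrow> (\<forall>v \<in> span_vars idx (svars (regex_spanner \<alpha>)). endpoint W (e v)) \<and>
        assignment idx (svars (regex_spanner \<alpha>)) W e \<in> spanner_eval (regex_spanner \<alpha>) (word_of W)"
      by (simp add: regex_spanner_def) (simp add: assignment_def)
    finally show "sat W (base_relations qs W) e \<psi> \<longleftrightarrow>
        (\<forall>v \<in> span_vars idx (svars (regex_spanner \<alpha>)). endpoint W (e v)) \<and>
        assignment idx (svars (regex_spanner \<alpha>)) W e \<in> spanner_eval (regex_spanner \<alpha>) (word_of W)" .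
  qed
  then show "\<exists>\<psi>. expresses qs idx (regex_spanner \<alpha>) \<psi>" ..
qed

text \<open>Different subexpressions need different states. Asking for expressibility over every
  closed list containing \<open>Q\<close> makes the condition monotone, so operands can be combined
  over the union of their state sets.\<close>

definition finitely_expressible :: "('a::finite, 'v) spanner \<Rightarrow> bool" where
  "finitely_expressible P \<longleftrightarrow>
     (\<exists>Q. finite Q \<and> (\<forall>K \<in> Q. \<forall>c. left_quotient [c] K \<in> Q) \<and>
        (\<forall>qs. Q \<subseteq> set qs \<longrightarrow> quotient_states qs \<longrightarrow> expressible qs P))"

lemma finitely_expressible_combine:
  assumes "finitely_expressible P" "finitely_expressible Q"
    and "\<And>qs. expressible qs P \<Longrightarrow> expressible qs Q \<Longrightarrow> expressible qs R"
  shows "finitely_expressible R"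
proof -
  obtain Q1 where Q1: "finite Q1" "\<forall>K \<in> Q1. \<forall>c. left_quotient [c] K \<in> Q1"
    "\<forall>qs. Q1 \<subseteq> set qs \<longrightarrow> quotient_states qs \<longrightarrow> expressible qs P"
    using assms(1) unfolding finitely_expressible_def by blast
  obtain Q2 where Q2: "finite Q2" "\<forall>K \<in> Q2. \<forall>c. left_quotient [c] K \<in> Q2"
    "\<forall>qs. Q2 \<subseteq> set qs \<longrightarrow> quotient_states qs \<longrightarrow> expressible qs Q"
    using assms(2) unfolding finitely_expressible_def by blast
  have "\<forall>K \<in> Q1 \<union> Q2. \<forall>c. left_quotient [c] K \<in> Q1 \<union> Q2"
    using Q1(2) Q2(2) by blast
  then show ?thesis
    unfolding finitely_expressible_def using Q1(1,3) Q2(1,3) assms(3)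
    by (intro exI[of _ "Q1 \<union> Q2"]) simp
qed

lemma finitely_expressible_regex:
  assumes "functional \<alpha>"
  shows "finitely_expressible (regex_spanner \<alpha>)"
  unfolding finitely_expressible_def
proof (intro exI[of _ "left_quotients (ref_words \<alpha>)"] conjI ballI allI impI)
  show "finite (left_quotients (ref_words \<alpha>))"
    by (rule finite_quotients_ref_words)
  show "left_quotient [c] K \<in> left_quotients (ref_words \<alpha>)"
    if K: "K \<in> left_quotients (ref_words \<alpha>)" for K c
  proof -
    obtain w where "K = left_quotient w (ref_words \<alpha>)"
      using K by auto
    then have "left_quotient [c] K = left_quotient (w @ [c]) (ref_words \<alpha>)"
      by (simp add: left_quotient_append)
    then show ?thesis
      by simp
  qed
  fix qs
  assume qs: "left_quotients (ref_words \<alpha>) \<subseteq> set qs" "quotient_states qs"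
  have "left_quotient [] (ref_words \<alpha>) \<in> set qs"
    using qs(1) by (rule subsetD) (rule rangeI)
  then show "expressible qs (regex_spanner \<alpha>)"
    using quotient_states.expressible_regex[OF qs(2) assms] by simp
qed

lemma generalized_core_spanner_expressible:
  "generalized_core_spanner P \<Longrightarrow> finitely_expressible P"
proof (induction rule: generalized_core_spanner.induct)
  case (regex \<alpha>)
  then show ?case
    by (rule finitely_expressible_regex)
next
  case (union P Q)
  show ?case
    by (rule finitely_expressible_combine[OF union.IH]) (rule expressible_union[OF _ _ union.hyps(3)])
next
  case (diff P Q)
  show ?case
    by (rule finitely_expressible_combine[OF diff.IH]) (rule expressible_diff[OF _ _ diff.hyps(3)])
next
  case (proj P Y)
  show ?case
    by (rule finitely_expressible_combine[OF proj.IH proj.IH])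
      (rule expressible_proj[OF _ generalized_core_spanner_proper[OF proj.hyps(1)] proj.hyps(2)])
next
  case (join P Q)
  show ?case
    by (rule finitely_expressible_combine[OF join.IH]) (rule expressible_join)
next
  case (eq_select P x y)
  show ?case
    by (rule finitely_expressible_combine[OF eq_select.IH eq_select.IH])
      (rule expressible_eq_select[OF _ generalized_core_spanner_proper[OF eq_select.hyps(1)] eq_select.hyps(2,3)])
qed

theorem theorem3p15:
  fixes P :: "('a::finite, 'v) spanner" and xs :: "'v list"
  assumes "generalized_core_spanner P"
    and "distinct xs" and "set xs = svars P"
  shows "spanner_relation P xs \<in> DynFO (2 * length xs)"
proof -
  obtain Q where Q: "finite Q" "\<forall>K \<in> Q. \<forall>c. left_quotient [c] K \<in> Q"
    "\<And>qs. Q \<subseteq> set qs \<Longrightarrow> quotient_states qs \<Longrightarrow> expressible qs P"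
    using generalized_core_spanner_expressible[OF assms(1)] unfolding finitely_expressible_def by blast
  obtain qs where qs: "set qs = Q"
    using finite_list[OF Q(1)] by blast
  interpret quotient_states qs
    using Q(2) qs by unfold_locales blast
  \<comment> \<open>Numbering by position in \<open>xs\<close> turns the variables of the formula
    into exactly the component indices of the tuples.\<close>
  define idx where "idx = the_inv_into {..<length xs} ((!) xs)"
  have inj_nth: "inj_on ((!) xs) {..<length xs}"
    using assms(2) by (simp add: inj_on_nth)
  have idx: "idx (xs ! i) = i" if "i < length xs" for i
    unfolding idx_def using that inj_nth by (simp add: the_inv_into_f_f)
  have "inj_on idx (svars P)"
    using idx unfolding assms(3)[symmetric] by (metis inj_onI in_set_conv_nth)
  then obtain \<psi> where \<psi>: "expresses qs idx P \<psi>"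
    using Q(3)[of qs] qs quotient_states_axioms by (auto simp: expressible_def)
  have vars: "v \<in> span_vars idx (svars P) \<longleftrightarrow> v < 2 * length xs" for v
  proof
    assume "v \<in> span_vars idx (svars P)"
    then show "v < 2 * length xs"
      using idx unfolding assms(3)[symmetric] by (auto simp: span_vars_def in_set_conv_nth)
  next
    assume "v < 2 * length xs"
    then have "v div 2 < length xs" "v = 2 * (v div 2) \<or> v = 2 * (v div 2) + 1"
      by auto
    then show "v \<in> span_vars idx (svars P)"
      using idx unfolding assms(3)[symmetric] span_vars_def
      by (intro UN_I[of "xs ! (v div 2)"]) auto
  qed
  have "spanner_relation P xs W = defined_relation (base_relations qs) (2 * length xs) \<psi> W" for W
  proof -
    have "(\<exists>\<mu> \<in> spanner_eval P (word_of W). \<forall>i < length xs. \<exists>a b. \<mu> (xs ! i) = Some (a, b) \<and>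
          represents W (ds ! (2 * i)) a \<and> represents W (ds ! (2 * i + 1)) b) \<longleftrightarrow>
        sat W (base_relations qs W) ((!) ds) \<psi>" (is "?L \<longleftrightarrow> ?R")
      if ds: "ds \<in> tuples W (2 * length xs)" for ds
    proof -
      have "\<forall>v \<in> span_vars idx (svars P). ds ! v \<in> dom_of W"
        using ds vars by (auto simp: tuples_def)
      then have R: "?R \<longleftrightarrow> (\<forall>v < 2 * length xs. endpoint W (ds ! v)) \<and>
          assignment idx (svars P) W ((!) ds) \<in> spanner_eval P (word_of W)"
        using \<psi> vars by (simp add: expresses_def Ball_def)
      have asg: "assignment idx (svars P) W ((!) ds) (xs ! i) = Some (rank W (ds ! (2 * i)), rank W (ds ! (2 * i + 1)))"
        if "i < length xs" for i
        using idx[OF that] nth_mem[OF that] unfolding assms(3) by (simp add: assignment_def)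
      show ?thesis
      proof
        assume ?L
        then obtain \<mu> where \<mu>: "\<mu> \<in> spanner_eval P (word_of W)"
          "\<And>i. i < length xs \<Longrightarrow> \<mu> (xs ! i) = Some (rank W (ds ! (2 * i)), rank W (ds ! (2 * i + 1)))"
          "\<And>i. i < length xs \<Longrightarrow> endpoint W (ds ! (2 * i)) \<and> endpoint W (ds ! (2 * i + 1))"
          by (fastforce simp: represents_iff)
        have "endpoint W (ds ! v)" if "v < 2 * length xs" for v
        proof -
          have "v div 2 < length xs" "v = 2 * (v div 2) \<or> v = 2 * (v div 2) + 1"
            using that by auto
          then show ?thesis
            using \<mu>(3)[of "v div 2"] by metis
        qed
        \<comment> \<open>Proper spanners have no values outside their variables, so agreement on
          the entries of \<open>xs\<close> is equality of maps.\<close>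
        moreover have "assignment idx (svars P) W ((!) ds) = \<mu>"
        proof
          fix x
          show "assignment idx (svars P) W ((!) ds) x = \<mu> x"
          proof (cases "x \<in> svars P")
            case True
            then obtain i where "i < length xs" "x = xs ! i"
              using assms(3) by (metis in_set_conv_nth)
            then show ?thesis
              using \<mu>(2) asg by simp
          next
            case False
            then show ?thesis
              using proper_spanner_eval(1)[OF generalized_core_spanner_proper[OF assms(1)] \<mu>(1)]
              by (metis dom_assignment domIff)
          qed
        qed
        ultimately show ?R
          using R \<mu>(1) by simp
      next
        assume ?R
        then show ?L
          using R asg by (intro bexI[of _ "assignment idx (svars P) W ((!) ds)"])
            (auto simp: represents_iff)
      qed
    qed
    then show ?thesis
      by (auto simp: spanner_relation_def defined_relation_def)
  qed
  then have "spanner_relation P xs = defined_relation (base_relations qs) (2 * length xs) \<psi>"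
    by blast
  moreover have "fv \<psi> \<subseteq> {..<2 * length xs}"
    using \<psi> vars by (auto simp: expresses_def)
  ultimately show ?thesis
    using defined_relation_in_DynFO[of \<psi> "2 * length xs"] \<psi> by (simp add: expresses_def)
qed

end
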